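(* Let $\Gamma$ be a group acting faithfully by homeomorphisms on a Cantor set $C$. Assume that $\Gamma$ is a topological full group, i.e. $\Gamma=[\![\Gamma]\!]$, and that the action is extremely proximal. Then the commutator subgroup $\Gamma'$ of $\Gamma$ is $9$-uniformly simple, and the commutator width of $\Gamma'$ is at most three. Therefore, if $\Gamma$ is perfect (i.e. $\Gamma'=\Gamma$), then $\Gamma$ is $9$-uniformly simple.
   Context: For a group $\Gamma$ acting on a Cantor set $C$ by homeomorphisms, the topological full group is $$[\![\Gamma]\!]=\{g\in\mathrm{Homeo}(C): \text{for each }x\in C\text{ there exist a neighbourhood }U\text{ of }x\text{ and }\gamma\in\Gamma\text{ such that }g|_U=\gamma|_U\}.$$ The action of $\Gamma$ on $C$ is extremely proximal if for any nonempty and proper clopen sets $V_1,V_2\subsetneq C$ there exists $g\in\Gamma$ such that $g(V_2)\subsetneq V_1$. A group $G$ is called $N$-uniformly simple if for every nontrivial $f\in G$ and every nontrivial conjugacy class $A\subset G$, the element $f$ is a product of at most $N$ elements of $A^{\pm1}=A\cup A^{-1}$. The commutator length of an element of $[G,G]$ is the minimal number of commutators of elements of $G$ whose product it is; the commutator width of $G$ is the maximum of the commutator lengths of the elements of $[G,G]$. *)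

theory Defs
  imports
    "HOL-Analysis.Analysis"
    "HOL-Algebra.Group_Action"
    "HOL-Algebra.Generated_Groups"
    "HOL-Library.Extended_Nat"
begin

definition cantor_space :: "'c topology \<Rightarrow> bool" where
  "cantor_space X \<longleftrightarrow>
     X homeomorphic_space
       product_topology (\<lambda>_. discrete_topology (UNIV :: bool set)) (UNIV :: nat set)"

(* Homeomorphisms are represented as extensional functions, matching the elements of
   BijGroup (topspace X), so that each homeomorphism has a unique representative. *)
definition homeo :: "'c topology \<Rightarrow> ('c \<Rightarrow> 'c) set" where
  "homeo X = {h \<in> extensional (topspace X). homeomorphic_map X X h}"

definition topological_full_group ::
    "'c topology \<Rightarrow> ('g, 'm) monoid_scheme \<Rightarrow> ('g \<Rightarrow> 'c \<Rightarrow> 'c) \<Rightarrow> ('c \<Rightarrow> 'c) set" where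
  "topological_full_group X G \<phi> =
     {h \<in> homeo X. \<forall>x \<in> topspace X. \<exists>U. openin X U \<and> x \<in> U \<and>
        (\<exists>\<gamma> \<in> carrier G. \<forall>y \<in> U. h y = \<phi> \<gamma> y)}"

definition clopen_in :: "'c topology \<Rightarrow> 'c set \<Rightarrow> bool" where
  "clopen_in X V \<longleftrightarrow> openin X V \<and> closedin X V"

definition extremely_proximal ::
    "'c topology \<Rightarrow> ('g, 'm) monoid_scheme \<Rightarrow> ('g \<Rightarrow> 'c \<Rightarrow> 'c) \<Rightarrow> bool" where
  "extremely_proximal X G \<phi> \<longleftrightarrow>
     (\<forall>V\<^sub>1 V\<^sub>2. clopen_in X V\<^sub>1 \<and> V\<^sub>1 \<noteq> {} \<and> V\<^sub>1 \<subset> topspace X \<and>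
              clopen_in X V\<^sub>2 \<and> V\<^sub>2 \<noteq> {} \<and> V\<^sub>2 \<subset> topspace X \<longrightarrow>
        (\<exists>g \<in> carrier G. \<phi> g ` V\<^sub>2 \<subset> V\<^sub>1))"

definition list_product :: "('g, 'm) monoid_scheme \<Rightarrow> 'g list \<Rightarrow> 'g" where
  "list_product G xs = foldr (\<otimes>\<^bsub>G\<^esub>) xs \<one>\<^bsub>G\<^esub>"

definition conjugacy_class :: "('g, 'm) monoid_scheme \<Rightarrow> 'g \<Rightarrow> 'g set" where
  "conjugacy_class G a = {g \<otimes>\<^bsub>G\<^esub> a \<otimes>\<^bsub>G\<^esub> inv\<^bsub>G\<^esub> g | g. g \<in> carrier G}"

definition conjugacy_classes :: "('g, 'm) monoid_scheme \<Rightarrow> 'g set set" where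
  "conjugacy_classes G = conjugacy_class G ` carrier G"

definition uniformly_simple :: "nat \<Rightarrow> ('g, 'm) monoid_scheme \<Rightarrow> bool" where
  "uniformly_simple N G \<longleftrightarrow> group G \<and>
     (\<forall>f \<in> carrier G. \<forall>A \<in> conjugacy_classes G.
        f \<noteq> \<one>\<^bsub>G\<^esub> \<and> A \<noteq> {\<one>\<^bsub>G\<^esub>} \<longrightarrow>
        (\<exists>xs. length xs \<le> N \<and> set xs \<subseteq> A \<union> (\<lambda>a. inv\<^bsub>G\<^esub> a) ` A \<and> list_product G xs = f))"

(* derived_set G (carrier G) is the set of commutators themselves, and
   derived G (carrier G) is the subgroup they generate. *)
definition commutator_length :: "('g, 'm) monoid_scheme \<Rightarrow> 'g \<Rightarrow> nat" where
  "commutator_length G f =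
     (LEAST n. \<exists>cs. length cs = n \<and> set cs \<subseteq> derived_set G (carrier G) \<and> list_product G cs = f)"

(* A supremum in enat, so that unbounded commutator lengths yield width \<infinity>;
   whenever the lengths are bounded it is attained. *)
definition commutator_width :: "('g, 'm) monoid_scheme \<Rightarrow> enat" where
  "commutator_width G = (SUP f \<in> derived G (carrier G). enat (commutator_length G f))"

definition commutator_subgroup :: "('g, 'm) monoid_scheme \<Rightarrow> ('g, 'm) monoid_scheme" where
  "commutator_subgroup G = G\<lparr>carrier := derived G (carrier G)\<rparr>"

(* The minimum defining commutator_length is taken over a nonempty set. *)
lemma (in group) commutator_length_attained:
  assumes "f \<in> derived G (carrier G)"
  shows "\<exists>cs. length cs = commutator_length G f \<and>
           set cs \<subseteq> derived_set G (carrier G) \<and> list_product G cs = f"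
proof -
  let ?D = "derived_set G (carrier G)"
  have DG: "?D \<subseteq> carrier G" using derived_set_in_carrier by blast
  have app: "list_product G (as @ bs) = list_product G as \<otimes> list_product G bs"
    if "set as \<subseteq> ?D" "set bs \<subseteq> ?D" for as bs
  proof -
    have cl: "list_product G xs \<in> carrier G" if "set xs \<subseteq> ?D" for xs
      using that DG unfolding list_product_def by (induction xs) auto
    show ?thesis using that(1)
    proof (induction as)
      case Nil
      then show ?case using cl[OF that(2)] by (simp add: list_product_def)
    next
      case (Cons a as)
      then have "a \<in> carrier G" "list_product G as \<in> carrier G" "list_product G bs \<in> carrier G"
        using DG cl that(2) by auto
      moreover have "list_product G (as @ bs) = list_product G as \<otimes> list_product G bs"
        using Cons by simp
      ultimately show ?case by (simp add: list_product_def m_assoc)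
    qed
  qed
  have inv_D: "inv h \<in> ?D" if "h \<in> ?D" for h
  proof -
    obtain a b where ab: "a \<in> carrier G" "b \<in> carrier G" "h = a \<otimes> b \<otimes> inv a \<otimes> inv b"
      using \<open>h \<in> ?D\<close> by blast
    then have "inv h = b \<otimes> a \<otimes> inv b \<otimes> inv a"
      by (simp add: inv_mult_group m_assoc)
    then show ?thesis using ab by blast
  qed
  have sing: "list_product G [h] = h" if "h \<in> ?D" for h
    using that DG by (auto simp: list_product_def)
  have "\<exists>cs. set cs \<subseteq> ?D \<and> list_product G cs = f"
    using assms unfolding derived_def
  proof (induction rule: generate.induct)
    case one
    show ?case by (intro exI[of _ "[]"]) (simp add: list_product_def)
  next
    case (incl h)
    then show ?case using sing by (intro exI[of _ "[h]"]) simp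
  next
    case (inv h)
    then show ?case using sing[OF inv_D[OF inv]] inv_D[OF inv]
      by (intro exI[of _ "[inv h]"]) simp
  next
    case (eng h1 h2)
    then obtain as bs where "set as \<subseteq> ?D" "list_product G as = h1"
      "set bs \<subseteq> ?D" "list_product G bs = h2" by blast
    then show ?case using app[of as bs] by (intro exI[of _ "as @ bs"]) simp
  qed
  then have "\<exists>n cs. length cs = n \<and> set cs \<subseteq> ?D \<and> list_product G cs = f" by blast
  then show ?thesis unfolding commutator_length_def by (rule LeastI_ex)
qed

end

theory Submission
  imports Defs
begin

text \<open>Let \<open>f\<close> and \<open>g\<close> be nontrivial elements of \<open>G'\<close>. Some conjugate of \<open>g\<close> agrees with \<open>f\<close> on a
  nonempty clopen set, so \<open>f\<close> is that conjugate times some \<open>f' \<in> G'\<close> with proper clopen support.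
  A piecewise-\<open>G\<close> embedding of the whole space into a small clopen set \<open>D\<close> that restricts to an element
  of \<open>G\<close> on the support of \<open>f'\<close> turns \<open>f'\<close>, up to conjugation, into a product of commutators of elements
  supported on \<open>D\<close>. If \<open>D = Z - h(Z)\<close>, where \<open>h(Z)\<close> is properly contained in \<open>Z\<close>, the translates
  \<open>h\<^sup>i(D)\<close> are disjoint and the Burago-Ivanov trick reduces the product to two commutators, whose entries
  can be taken in \<open>G'\<close> with support in a common proper clopen set; this gives width three. Moving that
  set into one displaced by \<open>g\<close> makes each of the two commutators a product of four conjugates of \<open>g\<close>
  and its inverse, and \<open>1 + 4 + 4 = 9\<close>.\<close>

section \<open>Commutator identities\<close>

context group
begin

definition comm :: "'a \<Rightarrow> 'a \<Rightarrow> 'a" where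
  "comm a b = a \<otimes> b \<otimes> inv a \<otimes> inv b"

lemma comm_closed [simp]: "a \<in> carrier G \<Longrightarrow> b \<in> carrier G \<Longrightarrow> comm a b \<in> carrier G"
  by (simp add: comm_def)

lemma inv_cancel_left [simp]:
  "x \<in> carrier G \<Longrightarrow> y \<in> carrier G \<Longrightarrow> inv x \<otimes> (x \<otimes> y) = y"
  "x \<in> carrier G \<Longrightarrow> y \<in> carrier G \<Longrightarrow> x \<otimes> (inv x \<otimes> y) = y"
  by (simp_all add: m_assoc [symmetric])

lemma conj_comm:
  assumes "a \<in> carrier G" "b \<in> carrier G" "c \<in> carrier G"
  shows "c \<otimes> comm a b \<otimes> inv c = comm (c \<otimes> a \<otimes> inv c) (c \<otimes> b \<otimes> inv c)"
  using assms by (simp add: comm_def m_assoc inv_mult_group)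

lemma commute_inv:
  assumes "a \<in> carrier G" "b \<in> carrier G" "a \<otimes> b = b \<otimes> a"
  shows "a \<otimes> inv b = inv b \<otimes> a"
proof -
  have "inv b \<otimes> (a \<otimes> b) \<otimes> inv b = inv b \<otimes> (b \<otimes> a) \<otimes> inv b" using assms(3) by simp
  then show ?thesis using assms(1,2) by (simp add: m_assoc)
qed

lemma left_commute:
  assumes "a \<in> carrier G" "b \<in> carrier G" "a \<otimes> b = b \<otimes> a" "z \<in> carrier G"
  shows "a \<otimes> (b \<otimes> z) = b \<otimes> (a \<otimes> z)"
  using assms by (simp add: m_assoc [symmetric])

lemma comm_commuting:
  assumes "a \<in> carrier G" "b \<in> carrier G" "a \<otimes> b = b \<otimes> a"
  shows "comm a b = \<one>"
  using assms by (simp add: comm_def m_assoc commute_inv)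

text \<open>Two commuting pairs behave as in a direct product, where commutators are taken
  componentwise. In the applications the commutation comes from disjoint supports.\<close>

lemma comm_mult_commuting:
  assumes x: "x \<in> carrier G" and y: "y \<in> carrier G" and u: "u \<in> carrier G" and v: "v \<in> carrier G"
    and xu: "x \<otimes> u = u \<otimes> x" and xv: "x \<otimes> v = v \<otimes> x"
    and yu: "y \<otimes> u = u \<otimes> y" and yv: "y \<otimes> v = v \<otimes> y"
  shows "comm (x \<otimes> u) (y \<otimes> v) = comm x y \<otimes> comm u v"
proof -
  have c: "a \<otimes> inv b = inv b \<otimes> a \<and> inv a \<otimes> b = b \<otimes> inv a \<and> inv a \<otimes> inv b = inv b \<otimes> inv a"
    if "a \<in> carrier G" "b \<in> carrier G" "a \<otimes> b = b \<otimes> a" for a b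
    using that commute_inv[of a b] commute_inv[of b a] commute_inv[of "inv b" a] by simp
  note cs = c[OF x u xu] c[OF x v xv] c[OF y u yu] c[OF y v yv] xu xv yu yv
  have L: "u \<otimes> (y \<otimes> z) = y \<otimes> (u \<otimes> z)" "u \<otimes> (inv x \<otimes> z) = inv x \<otimes> (u \<otimes> z)"
    "u \<otimes> (inv y \<otimes> z) = inv y \<otimes> (u \<otimes> z)" "v \<otimes> (inv x \<otimes> z) = inv x \<otimes> (v \<otimes> z)"
    "v \<otimes> (inv y \<otimes> z) = inv y \<otimes> (v \<otimes> z)" "inv u \<otimes> (inv y \<otimes> z) = inv y \<otimes> (inv u \<otimes> z)"
    "inv u \<otimes> (inv x \<otimes> z) = inv x \<otimes> (inv u \<otimes> z)" if "z \<in> carrier G" for z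
    using that x y u v cs by (auto intro!: left_commute)
  have L': "inv v \<otimes> inv y = inv y \<otimes> inv v" using cs by simp
  show ?thesis
    using x y u v by (simp add: comm_def m_assoc inv_mult_group L L')
qed

lemma derived_setI: "a \<in> H \<Longrightarrow> b \<in> H \<Longrightarrow> comm a b \<in> derived_set G H"
  unfolding comm_def by blast

lemma derived_setE:
  assumes "e \<in> derived_set G H"
  obtains a b where "a \<in> H" "b \<in> H" "e = comm a b"
  using assms by (auto simp: comm_def)

lemma comm_in_derived: "a \<in> carrier G \<Longrightarrow> b \<in> carrier G \<Longrightarrow> comm a b \<in> derived G (carrier G)"
  unfolding derived_def by (intro generate.incl derived_setI)

lemma list_product_closed [simp]:
  "set xs \<subseteq> carrier G \<Longrightarrow> list_product G xs \<in> carrier G"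
  by (induction xs) (auto simp: list_product_def)

lemma list_product_Nil [simp]: "list_product G [] = \<one>"
  by (simp add: list_product_def)

lemma list_product_Cons [simp]: "list_product G (x # xs) = x \<otimes> list_product G xs"
  by (simp add: list_product_def)

lemma list_product_append:
  "set xs \<subseteq> carrier G \<Longrightarrow> set ys \<subseteq> carrier G \<Longrightarrow>
    list_product G (xs @ ys) = list_product G xs \<otimes> list_product G ys"
  by (induction xs) (auto simp: m_assoc)

lemma list_product_hom:
  assumes "J \<in> hom G G" "set xs \<subseteq> carrier G"
  shows "J (list_product G xs) = list_product G (map J xs)"
proof -
  have "J \<one> = \<one>" using assms(1) by (simp add: hom_one is_group)
  then show ?thesis using assms(2)
    by (induction xs) (use assms(1) in \<open>auto simp: hom_mult\<close>)
qed

lemma hom_comm: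
  assumes "J \<in> hom G G" "a \<in> carrier G" "b \<in> carrier G"
  shows "J (comm a b) = comm (J a) (J b)"
proof -
  interpret group_hom G G J
    using assms(1) by (unfold_locales)
  show ?thesis using assms(2,3) by (simp add: comm_def)
qed

text \<open>If \<open>g\<close> carries the support of \<open>x\<close> off that of \<open>y\<close>, then \<open>[x, y] = [[x, g], y]\<close>, and the
  right-hand side is a product of four conjugates of \<open>g\<close> and its inverse.\<close>
lemma comm_as_conjugates:
  assumes x: "x \<in> carrier G" and y: "y \<in> carrier G" and g: "g \<in> carrier G"
    and xy: "g \<otimes> inv x \<otimes> inv g \<otimes> x = x \<otimes> (g \<otimes> inv x \<otimes> inv g)"
      "g \<otimes> inv x \<otimes> inv g \<otimes> y = y \<otimes> (g \<otimes> inv x \<otimes> inv g)"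
  shows "comm x y = list_product G [x \<otimes> g \<otimes> inv x, inv g, y \<otimes> g \<otimes> inv y,
           y \<otimes> x \<otimes> inv g \<otimes> inv (y \<otimes> x)]"
proof -
  define u where "u = g \<otimes> inv x \<otimes> inv g"
  have u: "u \<in> carrier G" using x g by (simp add: u_def)
  \<comment> \<open>Here \<open>x \<otimes> u\<close> is \<open>comm x g\<close>; pairing
    \<open>u\<close> with the identity absorbs it without changing the commutator.\<close>
  have "comm (x \<otimes> u) (y \<otimes> \<one>) = comm x y \<otimes> comm u \<one>"
    using x y u xy by (intro comm_mult_commuting) (simp_all add: u_def)
  then have "comm x y = comm (x \<otimes> u) y"
    using x y u by (simp add: comm_commuting)
  also have "\<dots> = list_product G [x \<otimes> g \<otimes> inv x, inv g, y \<otimes> g \<otimes> inv y,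
           y \<otimes> x \<otimes> inv g \<otimes> inv (y \<otimes> x)]"
    using x y g by (simp add: u_def comm_def m_assoc inv_mult_group)
  finally show ?thesis .
qed

text \<open>The Burago-Ivanov trick. With \<open>H\<close> and \<open>K\<close> the elements supported on \<open>D = Z - h(Z)\<close> and on
  \<open>h(Z)\<close>, the hypotheses express that \<open>h\<close> maps \<open>Z\<close> into itself.\<close>
lemma product_of_comms_as_two:
  assumes h: "h \<in> carrier G" and H: "subgroup H G" and K: "subgroup K G"
    and commute: "\<And>a b. a \<in> H \<Longrightarrow> b \<in> K \<Longrightarrow> a \<otimes> b = b \<otimes> a"
    and shift: "\<And>a b. a \<in> H \<Longrightarrow> b \<in> K \<Longrightarrow> h \<otimes> (a \<otimes> b) \<otimes> inv h \<in> K"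
    and cs: "set cs \<subseteq> derived_set G H"
  shows "\<exists>F \<in> carrier G. \<exists>A \<in> K. \<exists>B \<in> K. list_product G cs = comm F h \<otimes> comm A B"
  using cs
proof (induction cs)
  case Nil
  have "comm \<one> h \<otimes> comm \<one> \<one> = \<one>" using h by (simp add: comm_commuting)
  then show ?case using subgroup.one_closed[OF K] by force
next
  case (Cons c cs)
  then obtain F A B where F: "F \<in> carrier G" and AB: "A \<in> K" "B \<in> K"
    and f: "list_product G cs = comm F h \<otimes> comm A B" by auto
  obtain a b where ab: "a \<in> H" "b \<in> H" and c: "c = comm a b"
    using Cons.prems by (auto simp: comm_def)
  note sub = subgroup.subset[OF H, THEN subsetD] subgroup.subset[OF K, THEN subsetD]
  have car: "a \<in> carrier G" "b \<in> carrier G" "A \<in> carrier G" "B \<in> carrier G"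
    using ab AB sub by auto
  define p where "p = list_product G cs"
  have DH: "derived_set G H \<subseteq> H" using derived_set_incl[OF subset_refl H] .
  have pH: "p \<in> H" unfolding p_def using Cons.prems DH
  proof (induction cs)
    case Nil then show ?case using subgroup.one_closed[OF H] by simp
  next
    case (Cons x xs) then show ?case using subgroup.m_closed[OF H, of x] by auto
  qed
  have cH: "c \<in> H" using Cons.prems DH by auto
  have pc: "p \<in> carrier G" "c \<in> carrier G" using pH cH sub by auto
  define q where "q = comm A B"
  have qc: "q \<in> carrier G" using car by (simp add: q_def)
  have qK: "q \<in> K"
    unfolding q_def comm_def using AB subgroup.m_closed[OF K] subgroup.m_inv_closed[OF K] by simp
  have qp: "q \<otimes> p = p \<otimes> q" "c \<otimes> q = q \<otimes> c"
    using commute[OF pH qK] commute[OF cH qK] by simp_all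
  have Fh: "comm F h = p \<otimes> inv q"
    using f F h qc pc by (simp add: p_def q_def m_assoc)
  \<comment> \<open>This choice makes \<open>comm F' h\<close> equal to \<open>c \<otimes> p\<close>
    times the conjugate of \<open>inv (c \<otimes> q)\<close> by \<open>h\<close>. One commutator
    with \<open>h\<close> thus absorbs the new factor, and the error is the conjugate of
    \<open>c \<otimes> q\<close>.\<close>
  define F' where "F' = (c \<otimes> p) \<otimes> (h \<otimes> F \<otimes> inv h)"
  have "comm F' h = c \<otimes> p \<otimes> (h \<otimes> (comm F h \<otimes> inv p \<otimes> inv c) \<otimes> inv h)"
    using F h pc by (simp add: comm_def F'_def m_assoc inv_mult_group)
  also have "comm F h \<otimes> inv p \<otimes> inv c = inv (c \<otimes> q)"
  proof -
    have "inv q \<otimes> inv p = inv p \<otimes> inv q" using qp qc pc inv_mult_group by metis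
    then have "p \<otimes> inv q \<otimes> inv p = inv q" using qc pc by (simp add: m_assoc)
    then show ?thesis unfolding Fh using qc pc by (simp add: m_assoc inv_mult_group)
  qed
  finally have 1: "comm F' h = c \<otimes> p \<otimes> (h \<otimes> inv (c \<otimes> q) \<otimes> inv h)" .
  \<comment> \<open>\<open>c\<close> and \<open>q\<close> are commutators of mutually commuting
    pairs, so their product is a single commutator. Conjugation by \<open>h\<close> moves its
    entries into \<open>K\<close>, which restores the form needed for the induction.\<close>
  have "c \<otimes> q = comm (a \<otimes> A) (b \<otimes> B)"
    unfolding c q_def using car commute ab AB by (intro comm_mult_commuting [symmetric]) auto
  then have 2: "h \<otimes> (c \<otimes> q) \<otimes> inv h
      = comm (h \<otimes> (a \<otimes> A) \<otimes> inv h) (h \<otimes> (b \<otimes> B) \<otimes> inv h)"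
    using conj_comm car h by simp
  have "list_product G (c # cs) = comm F' h \<otimes> (h \<otimes> (c \<otimes> q) \<otimes> inv h)"
    unfolding 1 using h pc qc by (simp add: p_def [symmetric] m_assoc inv_mult_group)
  moreover have "F' \<in> carrier G" using F h pc by (simp add: F'_def)
  ultimately show ?case unfolding 2 using shift ab AB by blast
qed

end

section \<open>Extremely proximal full actions\<close>

text \<open>Topology enters only through the algebra \<open>clopens\<close>. The axiom
  \<open>glue\<close> is fullness, stated for bijections because local agreement with homeomorphisms
  already gives continuity in both directions.\<close>

locale full_proximal_action = group G + faithful_action G C \<phi>
  for G (structure) and C :: "'c set" and \<phi> +
  fixes clopens :: "'c set set"
  assumes clopen_subset: "K \<in> clopens \<Longrightarrow> K \<subseteq> C"
    and clopen_space: "C \<in> clopens"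
    and clopen_Diff: "K \<in> clopens \<Longrightarrow> L \<in> clopens \<Longrightarrow> K - L \<in> clopens"
    and clopen_Un: "K \<in> clopens \<Longrightarrow> L \<in> clopens \<Longrightarrow> K \<union> L \<in> clopens"
    and clopen_image: "g \<in> carrier G \<Longrightarrow> K \<in> clopens \<Longrightarrow> \<phi> g ` K \<in> clopens"
    and separation: "x \<in> C \<Longrightarrow> y \<in> C \<Longrightarrow> x \<noteq> y \<Longrightarrow> \<exists>K \<in> clopens. x \<in> K \<and> y \<notin> K"
    and glue: "bij_betw h C C \<Longrightarrow>
       (\<And>x. x \<in> C \<Longrightarrow> \<exists>K \<in> clopens. x \<in> K \<and> (\<exists>\<gamma> \<in> carrier G. \<forall>y \<in> K. h y = \<phi> \<gamma> y)) \<Longrightarrow>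
       \<exists>g \<in> carrier G. \<forall>x \<in> C. \<phi> g x = h x"
    and proximal: "U \<in> clopens \<Longrightarrow> U \<noteq> {} \<Longrightarrow> U \<noteq> C \<Longrightarrow> V \<in> clopens \<Longrightarrow> V \<noteq> {} \<Longrightarrow> V \<noteq> C \<Longrightarrow>
       \<exists>g \<in> carrier G. \<phi> g ` V \<subset> U"
begin

section \<open>Clopen sets and pointwise rules for the action\<close>

lemma clopen_Int: "K \<in> clopens \<Longrightarrow> L \<in> clopens \<Longrightarrow> K \<inter> L \<in> clopens"
  using clopen_Diff[of K "K - L"] clopen_Diff[of K L] by (simp add: Diff_Diff_Int)

lemma act_closed [simp]: "g \<in> carrier G \<Longrightarrow> x \<in> C \<Longrightarrow> \<phi> g x \<in> C"
  using element_image by blast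

lemma act_mult [simp]:
  "g \<in> carrier G \<Longrightarrow> h \<in> carrier G \<Longrightarrow> x \<in> C \<Longrightarrow> \<phi> (g \<otimes> h) x = \<phi> g (\<phi> h x)"
  using composition_rule by blast

lemma act_one [simp]: "x \<in> C \<Longrightarrow> \<phi> \<one> x = x"
  using id_eq_one by (metis restrict_apply')

lemma act_inv [simp]:
  assumes "g \<in> carrier G" "x \<in> C"
  shows "\<phi> (inv g) (\<phi> g x) = x" "\<phi> g (\<phi> (inv g) x) = x"
  using orbit_sym_aux[of g x] orbit_sym_aux[of "inv g" x] assms by auto

lemma act_eq_iff [simp]:
  "g \<in> carrier G \<Longrightarrow> x \<in> C \<Longrightarrow> y \<in> C \<Longrightarrow> \<phi> g x = \<phi> g y \<longleftrightarrow> x = y"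
  by (metis act_inv(1))

lemma act_eqI:
  assumes "g \<in> carrier G" "h \<in> carrier G" "\<And>x. x \<in> C \<Longrightarrow> \<phi> g x = \<phi> h x"
  shows "g = h"
proof -
  have "\<phi> g = \<phi> h"
    using assms bij_prop0 Bij_imp_extensional by (blast intro: extensionalityI)
  then show ?thesis using faithful assms(1,2) by (auto dest: inj_onD)
qed

lemma act_image_mult:
  "g \<in> carrier G \<Longrightarrow> h \<in> carrier G \<Longrightarrow> A \<subseteq> C \<Longrightarrow> \<phi> (g \<otimes> h) ` A = \<phi> g ` \<phi> h ` A"
  by (force simp: image_iff)

lemma act_image_subset: "g \<in> carrier G \<Longrightarrow> A \<subseteq> C \<Longrightarrow> \<phi> g ` A \<subseteq> C"
  by auto

lemma act_image_disjoint:
  assumes "g \<in> carrier G" "A \<subseteq> C" "B \<subseteq> C" "A \<inter> B = {}"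
  shows "\<phi> g ` A \<inter> \<phi> g ` B = {}"
  using assms inj_on_image_Int[OF inj_prop[OF assms(1)] assms(2,3)] by simp

lemma act_image_proper:
  assumes "g \<in> carrier G" "A \<subseteq> C" "A \<noteq> C"
  shows "\<phi> g ` A \<noteq> C"
proof
  assume "\<phi> g ` A = C"
  then have "\<phi> g ` A = \<phi> g ` C" using surj_prop assms(1) by simp
  then show False using inj_on_image_eq_iff[OF inj_prop[OF assms(1)]] assms(2,3) by blast
qed

section \<open>Elements supported on a given set\<close>

text \<open>The rigid stabiliser of \<open>D\<close>, the algebraic form of having support in
  \<open>D\<close>.\<close>

definition rist :: "'c set \<Rightarrow> 'a set" where
  "rist D = {g \<in> carrier G. \<forall>x \<in> C - D. \<phi> g x = x}"

lemma rist_carrier: "g \<in> rist D \<Longrightarrow> g \<in> carrier G"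
  by (simp add: rist_def)

lemma rist_fix: "g \<in> rist D \<Longrightarrow> x \<in> C \<Longrightarrow> x \<notin> D \<Longrightarrow> \<phi> g x = x"
  by (simp add: rist_def)

lemma rist_mono: "D \<subseteq> E \<Longrightarrow> g \<in> rist D \<Longrightarrow> g \<in> rist E"
  by (auto simp: rist_def)

lemma subgroup_rist: "subgroup (rist D) G"
proof (rule subgroupI)
  show "inv a \<in> rist D" if "a \<in> rist D" for a
  proof -
    have "\<phi> (inv a) x = x" if "x \<in> C - D" for x
      using that \<open>a \<in> rist D\<close> rist_carrier rist_fix by (metis DiffD1 DiffD2 act_inv(1))
    then show ?thesis using that by (simp add: rist_def)
  qed
  show "rist D \<noteq> {}"
    by (auto simp: rist_def intro!: exI[of _ \<one>])
qed (auto simp: rist_def)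

text \<open>If \<open>\<phi> g x\<close> lay outside \<open>D\<close>, it would be fixed by
  \<open>g\<close>, and injectivity would give \<open>\<phi> g x = x\<close>, a point of
  \<open>D\<close>.\<close>

lemma rist_maps:
  assumes "g \<in> rist D" "x \<in> C" "x \<in> D"
  shows "\<phi> g x \<in> D"
  using assms rist_carrier[OF assms(1)] rist_fix[OF assms(1), of "\<phi> g x"] by force

lemma rist_commute:
  assumes g: "g \<in> rist D" and h: "h \<in> rist E" and DE: "D \<inter> E = {}"
  shows "g \<otimes> h = h \<otimes> g"
proof (rule act_eqI)
  fix x assume x: "x \<in> C"
  note gh = rist_carrier[OF g] rist_carrier[OF h]
  consider "x \<in> D" | "x \<in> E" | "x \<notin> D" "x \<notin> E" by blast
  then show "\<phi> (g \<otimes> h) x = \<phi> (h \<otimes> g) x"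
  proof cases
    case 1
    then have "x \<notin> E" "\<phi> g x \<notin> E" using DE rist_maps[OF g x] by auto
    then show ?thesis using x gh rist_fix[OF h] by simp
  next
    case 2
    then have "x \<notin> D" "\<phi> h x \<notin> D" using DE rist_maps[OF h x] by auto
    then show ?thesis using x gh rist_fix[OF g] by simp
  next
    case 3
    then show ?thesis using x gh rist_fix[OF g] rist_fix[OF h] by simp
  qed
qed (use rist_carrier[OF g] rist_carrier[OF h] in simp_all)

lemma rist_conj:
  assumes "g \<in> rist D" "c \<in> carrier G"
  shows "c \<otimes> g \<otimes> inv c \<in> rist (\<phi> c ` D)"
proof -
  have "\<phi> (c \<otimes> g \<otimes> inv c) x = x" if "x \<in> C" "x \<notin> \<phi> c ` D" for x
  proof -
    have "\<phi> (inv c) x \<notin> D" using that assms(2) act_inv(2) by (metis imageI)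
    then show ?thesis using that assms rist_carrier[OF assms(1)] rist_fix[OF assms(1)] by simp
  qed
  then show ?thesis using assms rist_carrier[OF assms(1)] by (simp add: rist_def)
qed

section \<open>Displaced clopen sets and swaps\<close>

lemma moved_point:
  assumes "f \<in> carrier G" "f \<noteq> \<one>"
  obtains x where "x \<in> C" "\<phi> f x \<noteq> x"
  using act_eqI[of f \<one>] assms by fastforce

text \<open>A moved point can be separated from its image, which yields a clopen set disjoint from
  its image. Proximality then shrinks this set to leave room in \<open>C\<close>.\<close>

lemma displaced_clopen:
  assumes f: "f \<in> carrier G" "f \<noteq> \<one>"
  obtains V where "V \<in> clopens" "V \<noteq> {}" "V \<inter> \<phi> f ` V = {}" "V \<union> \<phi> f ` V \<noteq> C"
proof -
  obtain x where x: "x \<in> C" "\<phi> f x \<noteq> x" using moved_point f by blast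
  obtain K where K: "K \<in> clopens" "x \<in> K" "\<phi> f x \<notin> K"
    using separation[of x "\<phi> f x"] x f by auto
  \<comment> \<open>Removing the points that \<open>f\<close> keeps in \<open>K\<close> makes
    \<open>W\<close> disjoint from its image.\<close>
  define W where "W = K - \<phi> (inv f) ` K"
  have W: "W \<in> clopens" using K f by (simp add: W_def clopen_Diff clopen_image)
  have KC: "K \<subseteq> C" using K clopen_subset by blast
  have "x \<notin> \<phi> (inv f) ` K" using K f x KC act_inv(2) by force
  then have xW: "x \<in> W" using K by (simp add: W_def)
  have fW: "W \<inter> \<phi> f ` W = {}"
  proof -
    have False if "w \<in> W" "\<phi> f w \<in> W" for w
    proof -
      have "w \<in> C" "\<phi> f w \<in> K" using that KC by (auto simp: W_def)
      then have "w \<in> \<phi> (inv f) ` K" using f act_inv(1)[of f w] by (metis imageI)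
      then show False using that by (simp add: W_def)
    qed
    then show ?thesis by auto
  qed
  have "W \<noteq> C" using xW fW act_closed[OF f(1) x(1)] by auto
  then obtain g where g: "g \<in> carrier G" "\<phi> g ` W \<subset> W"
    using proximal[of W W] W xW by auto
  show ?thesis
  proof
    show "\<phi> g ` W \<in> clopens" using clopen_image g W by blast
    show "\<phi> g ` W \<noteq> {}" using xW by auto
    show "\<phi> g ` W \<inter> \<phi> f ` \<phi> g ` W = {}" using fW g by blast
    \<comment> \<open>A point of \<open>W\<close> outside the shrunken set is missed by both parts,
      since the image of \<open>W\<close> under \<open>f\<close> is disjoint from
      \<open>W\<close>.\<close>
    show "\<phi> g ` W \<union> \<phi> f ` \<phi> g ` W \<noteq> C" using fW g clopen_subset[OF W] by blast
  qed
qed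

text \<open>Exchanging \<open>V\<close> and its image by \<open>g\<close> and \<open>inv g\<close>,
  with the identity elsewhere, is an involution that agrees locally with the group, so fullness
  realises it.\<close>

lemma swap:
  assumes V: "V \<in> clopens" and g: "g \<in> carrier G" and disj: "V \<inter> \<phi> g ` V = {}"
  obtains t where "t \<in> rist (V \<union> \<phi> g ` V)" "\<And>x. x \<in> V \<Longrightarrow> \<phi> t x = \<phi> g x"
proof -
  define h where "h x = (if x \<in> V then \<phi> g x else if x \<in> \<phi> g ` V then \<phi> (inv g) x else x)" for x
  have VC: "V \<subseteq> C" using V clopen_subset by blast
  have hC: "h x \<in> C" if "x \<in> C" for x using that g by (simp add: h_def)
  have hh: "h (h x) = x" if x: "x \<in> C" for x
  proof -
    consider "x \<in> V" | v where "v \<in> V" "x = \<phi> g v" | "x \<notin> V" "x \<notin> \<phi> g ` V" by blast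
    then show ?thesis
    proof cases
      case 1
      then have "\<phi> g x \<in> \<phi> g ` V" "\<phi> g x \<notin> V" using disj by auto
      then show ?thesis using 1 x g by (simp add: h_def)
    next
      case 2
      then have "x \<in> \<phi> g ` V" "x \<notin> V" "\<phi> (inv g) x = v" using disj VC g by auto
      then show ?thesis using 2 by (simp add: h_def)
    next
      case 3
      then show ?thesis by (simp add: h_def)
    qed
  qed
  have "bij_betw h C C"
    using hC hh by (intro bij_betw_byWitness[of C h h C]) auto
  moreover have "\<exists>K \<in> clopens. x \<in> K \<and> (\<exists>\<gamma> \<in> carrier G. \<forall>y \<in> K. h y = \<phi> \<gamma> y)" if x: "x \<in> C" for x
  proof -
    consider "x \<in> V" | "x \<in> \<phi> g ` V" | "x \<in> C - (V \<union> \<phi> g ` V)" using x by blast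
    then show ?thesis
    proof cases
      case 1
      then show ?thesis using V g by (intro bexI[of _ V] conjI bexI[of _ g]) (auto simp: h_def)
    next
      case 2
      then show ?thesis using V g clopen_image disj
        by (intro bexI[of _ "\<phi> g ` V"] conjI bexI[of _ "inv g"]) (auto simp: h_def)
    next
      case 3
      then show ?thesis using V g clopen_image clopen_Diff clopen_Un clopen_space
        by (intro bexI[of _ "C - (V \<union> \<phi> g ` V)"] conjI bexI[of _ \<one>]) (auto simp: h_def)
    qed
  qed
  ultimately obtain t where "t \<in> carrier G" "\<forall>x \<in> C. \<phi> t x = h x" using glue by blast
  moreover from this have "t \<in> rist (V \<union> \<phi> g ` V)" by (simp add: rist_def h_def)
  ultimately show ?thesis using that[of t] VC by (metis h_def subsetD)
qed

section \<open>Realising swaps and proximality inside the commutator subgroup\<close>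

abbreviation (input) G' :: "'a set" where "G' \<equiv> derived G (carrier G)"

lemma subgroup_G': "subgroup G' G"
  using derived_is_subgroup by blast

lemma G'_carrier: "g \<in> G' \<Longrightarrow> g \<in> carrier G"
  using derived_in_carrier by blast

lemma G'_conj: "g \<in> G' \<Longrightarrow> c \<in> carrier G \<Longrightarrow> c \<otimes> g \<otimes> inv c \<in> G'"
  by (rule normal.inv_op_closed2 [OF derived_self_is_normal])

text \<open>Any \<open>d\<close> moving \<open>S\<close> off itself gives \<open>[t, d]\<close>, which agrees with \<open>t\<close> on \<open>S\<close>.\<close>
lemma derived_agrees_on_support:
  assumes t: "t \<in> rist S" and S: "S \<in> clopens" "S \<noteq> C"
  obtains t' where "t' \<in> G'" "\<And>x. x \<in> S \<Longrightarrow> \<phi> t' x = \<phi> t x"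
proof (cases "S = {}")
  case True
  then show ?thesis using that subgroup.one_closed[OF subgroup_G'] by blast
next
  case False
  have SC: "S \<subseteq> C" using S clopen_subset by blast
  obtain d where d: "d \<in> carrier G" "\<phi> d ` S \<subset> C - S"
    using proximal[of "C - S" S] S False SC clopen_Diff clopen_space by blast
  have tc: "t \<in> carrier G" using t rist_carrier by blast
  have 1: "d \<otimes> inv t \<otimes> inv d \<in> rist (\<phi> d ` S)"
    using rist_conj d(1) t subgroup.m_inv_closed[OF subgroup_rist] by blast
  have "comm t d = t \<otimes> (d \<otimes> inv t \<otimes> inv d)" using tc d by (simp add: comm_def m_assoc)
  then have "\<phi> (comm t d) x = \<phi> t x" if "x \<in> S" for x
  proof -
    have "x \<in> C" "x \<notin> \<phi> d ` S" using that SC d(2) by auto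
    then have "\<phi> (d \<otimes> inv t \<otimes> inv d) x = x" using rist_fix[OF 1] by blast
    then show ?thesis using \<open>comm t d = _\<close> tc d \<open>x \<in> C\<close> act_mult[of t "d \<otimes> inv t \<otimes> inv d" x]
      by (metis inv_closed m_closed)
  qed
  then show ?thesis using that comm_in_derived tc d by blast
qed

text \<open>The swap has proper support, so its commutator with a displacing element keeps its
  values there. This transfers the action of \<open>g\<close> on \<open>V\<close> to an element of
  \<open>G'\<close>.\<close>

lemma derived_swap:
  assumes V: "V \<in> clopens" and g: "g \<in> carrier G" and disj: "V \<inter> \<phi> g ` V = {}"
    and ne: "V \<union> \<phi> g ` V \<noteq> C"
  obtains t where "t \<in> G'" "\<And>x. x \<in> V \<Longrightarrow> \<phi> t x = \<phi> g x"
proof -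
  obtain t where "t \<in> rist (V \<union> \<phi> g ` V)" "\<And>x. x \<in> V \<Longrightarrow> \<phi> t x = \<phi> g x"
    using swap V g disj by blast
  then show ?thesis
    using derived_agrees_on_support[of t "V \<union> \<phi> g ` V"] V g ne clopen_Un clopen_image that
    by (metis UnCI)
qed

text \<open>An element moving \<open>V\<close> into \<open>U\<close> may fail the hypotheses of
  \<open>derived_swap\<close>, since the image can overlap \<open>V\<close>. So \<open>V\<close>
  first goes to a set \<open>E\<close> off itself, and \<open>E\<close> then goes into the part of
  \<open>U\<close> outside \<open>E\<close>.\<close>

lemma derived_proximal:
  assumes U: "U \<in> clopens" "U \<noteq> {}" "U \<noteq> C" and V: "V \<in> clopens" "V \<noteq> {}" "V \<noteq> C"
  obtains g where "g \<in> G'" "\<phi> g ` V \<subseteq> U"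
proof -
  have UC: "U \<subseteq> C" and VC: "V \<subseteq> C" using U V clopen_subset by auto
  \<comment> \<open>\<open>A\<close> lies off \<open>V\<close> so that the first move can be a swap,
    and it does not contain \<open>U\<close> so that \<open>U - E\<close> is nonempty for every
    \<open>E\<close> inside \<open>A\<close>.\<close>
  have "\<exists>A \<in> clopens. A \<noteq> {} \<and> A \<subseteq> C - V \<and> \<not> U \<subseteq> A"
  proof (cases "U \<subseteq> C - V")
    case False
    then show ?thesis using V VC clopen_Diff clopen_space by (intro bexI[of _ "C - V"]) auto
  next
    case True
    obtain g where "g \<in> carrier G" "\<phi> g ` U \<subset> U" using proximal U by blast
    then show ?thesis using True U clopen_image by (intro bexI[of _ "\<phi> g ` U"]) auto
  qed
  then obtain A where A: "A \<in> clopens" "A \<noteq> {}" "A \<subseteq> C - V" "\<not> U \<subseteq> A" by blast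
  then obtain e where e: "e \<in> carrier G" "\<phi> e ` V \<subset> A"
    using proximal[of A V] V VC by blast
  define E where "E = \<phi> e ` V"
  have E: "E \<in> clopens" "E \<noteq> {}" "E \<subset> A" using e V clopen_image by (auto simp: E_def)
  obtain s where s: "s \<in> G'" "\<And>x. x \<in> V \<Longrightarrow> \<phi> s x = \<phi> e x"
    using derived_swap[of V e] V e A by blast
  have UE: "U - E \<noteq> {}" "U - E \<noteq> C" "U - E \<in> clopens" using A E U UC clopen_Diff by auto
  obtain d where d: "d \<in> carrier G" "\<phi> d ` E \<subset> U - E"
    using proximal[of "U - E" E] UE E A by blast
  have dE: "E \<inter> \<phi> d ` E = {}" "E \<union> \<phi> d ` E \<noteq> C" using d UC by auto
  obtain r where r: "r \<in> G'" "\<And>x. x \<in> E \<Longrightarrow> \<phi> r x = \<phi> d x"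
    using derived_swap[OF E(1) d(1) dE] by blast
  have "\<phi> (r \<otimes> s) ` V = \<phi> r ` \<phi> s ` V" using act_image_mult r(1) s(1) VC G'_carrier by simp
  also have "\<phi> s ` V = E" using s by (simp add: E_def)
  also have "\<phi> r ` E = \<phi> d ` E" using r by simp
  finally have "\<phi> (r \<otimes> s) ` V \<subseteq> U" using d by blast
  then show ?thesis using that r(1) s(1) subgroup.m_closed[OF subgroup_G'] by blast
qed

text \<open>First conjugate \<open>g\<close> so that it displaces a clopen set \<open>W1\<close> with \<open>W1\<close> and its image away from
  \<open>V\<close> and \<open>f V\<close>; then exchange \<open>W1\<close> with a part of \<open>V\<close>, and the image of \<open>W1\<close> with that of this part
  under \<open>f\<close>.\<close>
lemma agree_on_clopen:
  assumes f: "f \<in> G'" "f \<noteq> \<one>" and g: "g \<in> G'" "g \<noteq> \<one>"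
  obtains c V where "c \<in> G'" "V \<in> clopens" "V \<noteq> {}" "V \<noteq> C"
    "\<And>x. x \<in> V \<Longrightarrow> \<phi> (c \<otimes> g \<otimes> inv c) x = \<phi> f x"
proof -
  note car = G'_carrier[OF f(1)] G'_carrier[OF g(1)]
  obtain V where V: "V \<in> clopens" "V \<noteq> {}" "V \<inter> \<phi> f ` V = {}" "V \<union> \<phi> f ` V \<noteq> C"
    using displaced_clopen car f by blast
  obtain W where W: "W \<in> clopens" "W \<noteq> {}" "W \<inter> \<phi> g ` W = {}" "W \<union> \<phi> g ` W \<noteq> C"
    using displaced_clopen car g by blast
  have VC: "V \<subseteq> C" and WC: "W \<subseteq> C" using V W clopen_subset by auto
  have fVC: "\<phi> f ` V \<subseteq> C" and gWC: "\<phi> g ` W \<subseteq> C" using act_image_subset car VC WC by auto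
  define D where "D = C - (V \<union> \<phi> f ` V)"
  have D: "D \<in> clopens"
    unfolding D_def using V car clopen_Diff clopen_Un clopen_space clopen_image by simp
  have "D \<noteq> {}" "D \<noteq> C" using V VC fVC by (auto simp: D_def)
  note D = D this
  \<comment> \<open>\<open>E\<close> is taken strictly inside \<open>D\<close> so that a point of
    \<open>D\<close> survives outside the set \<open>S\<close> below, which makes \<open>S\<close>
    proper.\<close>
  obtain p where "p \<in> carrier G" "\<phi> p ` D \<subset> D" using proximal[OF D D] by blast
  define E where "E = \<phi> p ` D"
  have E: "E \<in> clopens" "E \<noteq> {}" "E \<noteq> C" "E \<subset> D"
    using \<open>p \<in> _\<close> \<open>\<phi> p ` D \<subset> D\<close> D clopen_image clopen_subset[OF D(1)] by (auto simp: E_def)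
  obtain \<gamma> where \<gamma>: "\<gamma> \<in> G'" "\<phi> \<gamma> ` (W \<union> \<phi> g ` W) \<subseteq> E"
    using derived_proximal[of E "W \<union> \<phi> g ` W"] E W car clopen_Un clopen_image by blast
  have \<gamma>c: "\<gamma> \<in> carrier G" using \<gamma> G'_carrier by blast
  define g1 where "g1 = \<gamma> \<otimes> g \<otimes> inv \<gamma>"
  define W1 where "W1 = \<phi> \<gamma> ` W"
  have g1: "g1 \<in> carrier G" using car \<gamma>c by (simp add: g1_def)
  have W1: "W1 \<in> clopens" "W1 \<noteq> {}" "W1 \<subseteq> C" using W \<gamma>c clopen_image clopen_subset by (auto simp: W1_def)
  have g1W1: "\<phi> g1 ` W1 = \<phi> \<gamma> ` \<phi> g ` W"
    using act_image_mult car \<gamma>c WC gWC by (simp add: g1_def W1_def image_image subset_eq)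
  have W1E: "W1 \<subseteq> E" "\<phi> g1 ` W1 \<subseteq> E" using \<gamma>(2) unfolding g1W1 by (auto simp: W1_def)
  have disj1: "W1 \<inter> \<phi> g1 ` W1 = {}"
    unfolding g1W1 unfolding W1_def using act_image_disjoint \<gamma>c WC gWC W by blast
  have "W1 \<noteq> C" using W1E E(3) clopen_subset[OF E(1)] by blast
  moreover have "V \<noteq> C" using V(2,3) fVC by blast
  ultimately obtain \<delta> where \<delta>: "\<delta> \<in> carrier G" "\<phi> \<delta> ` W1 \<subset> V"
    using proximal[of V W1] V W1 by auto
  define V1 where "V1 = \<phi> \<delta> ` W1"
  have V1: "V1 \<in> clopens" "V1 \<noteq> {}" "V1 \<subseteq> V" using \<delta> W1 clopen_image by (auto simp: V1_def)
  have EV: "E \<inter> V = {}" "E \<inter> \<phi> f ` V = {}" using E(4) by (auto simp: D_def)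
  have WV1: "W1 \<inter> V1 = {}" using EV V1(3) W1E by blast
  obtain t1 where t1: "t1 \<in> rist (W1 \<union> V1)" "\<And>x. x \<in> W1 \<Longrightarrow> \<phi> t1 x = \<phi> \<delta> x"
    using swap[OF W1(1) \<delta>(1)] WV1 unfolding V1_def [symmetric] by blast
  \<comment> \<open>This choice sends \<open>\<phi> g1 x\<close> to
    \<open>\<phi> f (\<phi> \<delta> x)\<close>, while \<open>t1\<close> sends \<open>x\<close> in
    \<open>W1\<close> to \<open>\<phi> \<delta> x\<close>. Conjugating \<open>g1\<close> by the
    product of the two swaps therefore gives \<open>f\<close> on \<open>V1\<close>.\<close>
  define \<epsilon> where "\<epsilon> = f \<otimes> \<delta> \<otimes> inv g1"
  have \<epsilon>: "\<epsilon> \<in> carrier G" using car \<delta> g1 by (simp add: \<epsilon>_def)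
  have \<epsilon>x: "\<phi> \<epsilon> (\<phi> g1 x) = \<phi> f (\<phi> \<delta> x)" if "x \<in> C" for x
    using that car \<delta> g1 by (simp add: \<epsilon>_def)
  have \<epsilon>W: "\<phi> \<epsilon> ` \<phi> g1 ` W1 = \<phi> f ` V1"
    using \<epsilon>x W1 by (simp add: V1_def image_image subset_eq)
  have fV1: "\<phi> f ` V1 \<subseteq> \<phi> f ` V" using V1(3) by (rule image_mono)
  have gWV1: "\<phi> g1 ` W1 \<inter> \<phi> f ` V1 = {}"
    using Int_mono[OF W1E(2) fV1] EV(2) by simp
  obtain t2 where t2: "t2 \<in> rist (\<phi> g1 ` W1 \<union> \<phi> f ` V1)" "\<And>x. x \<in> \<phi> g1 ` W1 \<Longrightarrow> \<phi> t2 x = \<phi> \<epsilon> x"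
    using swap[OF clopen_image[OF g1 W1(1)] \<epsilon>] gWV1 unfolding \<epsilon>W by blast
  define S where "S = (W1 \<union> V1) \<union> (\<phi> g1 ` W1 \<union> \<phi> f ` V1)"
  have S: "S \<in> clopens" using W1 V1 car g1 clopen_Un clopen_image by (simp add: S_def)
  obtain x0 where "x0 \<in> D" "x0 \<notin> E" using E(4) by blast
  then have "x0 \<in> C" "x0 \<notin> S" using W1E V1(3) fV1 by (auto simp: S_def D_def)
  then have SC: "S \<noteq> C" by blast
  have tS: "t1 \<otimes> t2 \<in> rist S"
    using subgroup.m_closed[OF subgroup_rist] rist_mono t1(1) t2(1) unfolding S_def by (meson Un_upper1 Un_upper2)
  have tc: "t1 \<in> carrier G" "t2 \<in> carrier G" using t1(1) t2(1) rist_carrier by auto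
  have tW: "\<phi> (t1 \<otimes> t2) x = \<phi> \<delta> x" if "x \<in> W1" for x
  proof -
    have "x \<notin> \<phi> g1 ` W1" using that disj1 by (meson disjoint_iff)
    moreover have "x \<notin> \<phi> f ` V1" using that W1E(1) EV(2) fV1 by (meson disjoint_iff subset_iff)
    ultimately have "x \<notin> \<phi> g1 ` W1 \<union> \<phi> f ` V1" by simp
    then have "\<phi> t2 x = x" using rist_fix[OF t2(1)] that W1 by blast
    then show ?thesis using t1(2)[OF that] tc that W1 by auto
  qed
  have tgW: "\<phi> (t1 \<otimes> t2) (\<phi> g1 x) = \<phi> f (\<phi> \<delta> x)" if "x \<in> W1" for x
  proof -
    have xC: "x \<in> C" using that W1 by blast
    have 1: "\<phi> t2 (\<phi> g1 x) = \<phi> f (\<phi> \<delta> x)" using t2(2) \<epsilon>x that xC by simp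
    have "\<phi> f (\<phi> \<delta> x) \<in> \<phi> f ` V1" using that by (auto simp: V1_def)
    then have "\<phi> f (\<phi> \<delta> x) \<in> \<phi> f ` V" using fV1 by (rule subsetD [rotated])
    then have "\<phi> f (\<phi> \<delta> x) \<in> C" "\<phi> f (\<phi> \<delta> x) \<notin> W1 \<union> V1"
      using V(3) V1(3) W1E(1) EV(2) fVC by (auto simp: disjoint_iff)
    then have "\<phi> t1 (\<phi> f (\<phi> \<delta> x)) = \<phi> f (\<phi> \<delta> x)"
      by (rule rist_fix[OF t1(1)])
    then show ?thesis using 1 tc g1 xC by simp
  qed
  \<comment> \<open>The swaps may lie outside \<open>G'\<close>, but only their values on
    \<open>W1\<close> and on its image under \<open>g1\<close> matter, and both sets lie in
    \<open>S\<close>.\<close>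
  obtain t where t: "t \<in> G'" "\<And>x. x \<in> S \<Longrightarrow> \<phi> t x = \<phi> (t1 \<otimes> t2) x"
    using derived_agrees_on_support[OF tS S SC] by blast
  have tcar: "t \<in> carrier G" using t(1) G'_carrier by blast
  show ?thesis
  proof
    show "t \<otimes> \<gamma> \<in> G'" using t(1) \<gamma>(1) subgroup.m_closed[OF subgroup_G'] by blast
    show "V1 \<in> clopens" "V1 \<noteq> {}" "V1 \<noteq> C" using V1 \<open>V \<noteq> C\<close> VC by auto
    fix v assume "v \<in> V1"
    then obtain x where x: "x \<in> W1" "v = \<phi> \<delta> x" by (auto simp: V1_def)
    have xC: "x \<in> C" using x W1 by blast
    have tx: "\<phi> t x = v" using t(2)[of x] tW[OF x(1)] x by (simp add: S_def)
    have "\<phi> g1 x \<in> S" using x by (simp add: S_def)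
    then have tgx: "\<phi> t (\<phi> g1 x) = \<phi> f v" using t(2) tgW[OF x(1)] x by simp
    have "(t \<otimes> \<gamma>) \<otimes> g \<otimes> inv (t \<otimes> \<gamma>) = t \<otimes> g1 \<otimes> inv t"
      using tcar \<gamma>c car by (simp add: g1_def m_assoc inv_mult_group)
    moreover have "\<phi> (t \<otimes> g1 \<otimes> inv t) (\<phi> t x) = \<phi> f v"
      using tgx tcar g1 xC by simp
    ultimately show "\<phi> (t \<otimes> \<gamma> \<otimes> g \<otimes> inv (t \<otimes> \<gamma>)) v = \<phi> f v" using tx by simp
  qed
qed

section \<open>Compression into small sets and reduction to two commutators\<close>

text \<open>A piecewise-\<open>G\<close> embedding \<open>j\<close> of all of \<open>C\<close> into \<open>D\<close>, equal to some \<open>c\<close> on \<open>U\<close>, conjugates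
  the whole group into \<open>rist D\<close>. Hence an element of \<open>G'\<close> supported on \<open>U\<close> is, up to conjugation,
  a product of commutators of elements supported on \<open>D\<close>.\<close>
lemma compression:
  assumes U: "U \<in> clopens" "U \<noteq> {}" "U \<noteq> C" and D: "D \<in> clopens" "D \<noteq> {}" "D \<noteq> C"
  obtains J c where "J \<in> hom G G" "\<And>a. a \<in> carrier G \<Longrightarrow> J a \<in> rist D" "c \<in> carrier G"
    "\<And>x. x \<in> rist U \<Longrightarrow> J x = c \<otimes> x \<otimes> inv c"
proof -
  have UC: "U \<subseteq> C" and DC: "D \<subseteq> C" using U D clopen_subset by auto
  obtain c where c: "c \<in> carrier G" "\<phi> c ` U \<subset> D" using proximal[OF D U] by blast
  \<comment> \<open>The complement of \<open>U\<close> is sent into what \<open>c\<close> leaves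
    free in \<open>D\<close>, so the two images are disjoint and \<open>j\<close> is
    injective.\<close>
  have P: "D - \<phi> c ` U \<in> clopens" "D - \<phi> c ` U \<noteq> {}" "D - \<phi> c ` U \<noteq> C"
    using c U D DC clopen_Diff clopen_image by auto
  have Q: "C - U \<in> clopens" "C - U \<noteq> {}" "C - U \<noteq> C"
    using U UC clopen_Diff clopen_space by auto
  obtain d where d: "d \<in> carrier G" "\<phi> d ` (C - U) \<subset> D - \<phi> c ` U"
    using proximal[OF P Q] by blast
  define j where "j x = (if x \<in> U then \<phi> c x else \<phi> d x)" for x
  have jcl: "j x \<in> D" "j x \<in> C" if "x \<in> C" for x
    using that c d DC by (auto simp: j_def)
  have jU: "j x \<in> \<phi> c ` U \<longleftrightarrow> x \<in> U" if "x \<in> C" for x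
  proof (cases "x \<in> U")
    case False
    then have "\<phi> d x \<in> D - \<phi> c ` U" using d(2) that by blast
    then show ?thesis using False by (simp add: j_def)
  qed (simp add: j_def)
  have j_inj: "inj_on j C"
  proof (rule inj_onI)
    fix x y assume xy: "x \<in> C" "y \<in> C" "j x = j y"
    have "x \<in> U \<longleftrightarrow> y \<in> U" using jU[of x] jU[of y] xy by simp
    then show "x = y" using xy c d by (auto simp: j_def split: if_splits)
  qed
  have "j ` C = \<phi> c ` U \<union> \<phi> d ` (C - U)" using UC by (auto simp: j_def)
  then have jC: "j ` C \<in> clopens"
    using c d U clopen_image clopen_Un clopen_Diff clopen_space by auto
  have jloc: "\<exists>K \<in> clopens. x \<in> K \<and> (\<exists>\<gamma> \<in> carrier G. \<forall>y \<in> K. j y = \<phi> \<gamma> y)" if x: "x \<in> C" for x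
  proof (cases "x \<in> U")
    case True
    then show ?thesis using U c by (intro bexI[of _ U] conjI bexI[of _ c]) (auto simp: j_def)
  next
    case False
    then show ?thesis using U d x clopen_Diff clopen_space
      by (intro bexI[of _ "C - U"] conjI bexI[of _ d]) (auto simp: j_def)
  qed
  define h where "h a y = (if y \<in> j ` C then j (\<phi> a (inv_into C j y)) else y)" for a y
  have hj [simp]: "h a (j x) = j (\<phi> a x)" if "x \<in> C" for a x
    using that j_inj by (simp add: h_def)
  have ho: "h a y = y" if "y \<notin> j ` C" for a y using that by (simp add: h_def)
  have "\<exists>g \<in> carrier G. \<forall>x \<in> C. \<phi> g x = h a x" if a: "a \<in> carrier G" for a
  proof (rule glue)
    have hC: "h b y \<in> C" if "b \<in> carrier G" "y \<in> C" for b y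
      using that jcl(2) ho[of y b] by (cases "y \<in> j ` C") auto
    have hh: "h b (h b' y) = y" if "b \<in> carrier G" "b' \<in> carrier G" "y \<in> C" "b \<otimes> b' = \<one>" for b b' y
    proof (cases "y \<in> j ` C")
      case True
      then obtain x where x: "x \<in> C" "y = j x" by blast
      then have "\<phi> b (\<phi> b' x) = x" using that act_mult[of b b' x] by simp
      then show ?thesis using x that by simp
    qed (simp add: ho)
    show "bij_betw (h a) C C"
      by (rule bij_betw_byWitness[where f' = "h (inv a)"]) (use a hC hh in auto)
    fix y assume y: "y \<in> C"
    show "\<exists>K \<in> clopens. y \<in> K \<and> (\<exists>\<gamma> \<in> carrier G. \<forall>z \<in> K. h a z = \<phi> \<gamma> z)"
    proof (cases "y \<in> j ` C")
      case False
      then show ?thesis using y jC clopen_Diff clopen_space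
        by (intro bexI[of _ "C - j ` C"] conjI bexI[of _ \<one>]) (auto simp: ho)
    next
      case True
      then obtain x where x: "x \<in> C" "y = j x" by blast
      obtain K p where K: "K \<in> clopens" "x \<in> K" and p: "p \<in> carrier G" "\<And>z. z \<in> K \<Longrightarrow> j z = \<phi> p z"
        using jloc[OF x(1)] by blast
      obtain L q where L: "L \<in> clopens" "\<phi> a x \<in> L" and q: "q \<in> carrier G" "\<And>z. z \<in> L \<Longrightarrow> j z = \<phi> q z"
        using jloc[of "\<phi> a x"] x a by auto
      \<comment> \<open>Near \<open>y\<close> the map \<open>h a\<close> undoes \<open>j\<close>,
        applies \<open>a\<close> and redoes \<open>j\<close>. On \<open>M\<close> the map
        \<open>j\<close> is \<open>p\<close>, and \<open>a\<close> carries \<open>M\<close> into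
        \<open>L\<close>, where \<open>j\<close> is \<open>q\<close>; so
        \<open>q \<otimes> a \<otimes> inv p\<close> represents \<open>h a\<close> near
        \<open>y\<close>.\<close>
      define M where "M = K \<inter> \<phi> (inv a) ` L"
      have M: "M \<in> clopens" using K L a clopen_image clopen_Int by (simp add: M_def)
      have KC: "K \<subseteq> C" and LC: "L \<subseteq> C" using K L clopen_subset by auto
      have xM: "x \<in> M" using K L x a act_inv(1)[of a x] unfolding M_def by (metis IntI imageI)
      have Mz: "z \<in> C" "z \<in> K" "\<phi> a z \<in> L" if "z \<in> M" for z
        using that KC LC a by (auto simp: M_def)
      show ?thesis
      proof (intro bexI conjI ballI)
        show "\<phi> p ` M \<in> clopens" using p M clopen_image by blast
        show "y \<in> \<phi> p ` M" using x xM p K by auto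
        show "q \<otimes> a \<otimes> inv p \<in> carrier G" using p q a by simp
        fix w assume "w \<in> \<phi> p ` M"
        then obtain z where z: "z \<in> M" "w = \<phi> p z" by blast
        then have "h a w = j (\<phi> a z)" using hj[of z a] Mz[of z] p by simp
        then show "h a w = \<phi> (q \<otimes> a \<otimes> inv p) w" using z Mz[of z] p q a by simp
      qed
    qed
  qed
  then obtain J where J: "\<And>a. a \<in> carrier G \<Longrightarrow> J a \<in> carrier G"
    and Jh: "\<And>a x. a \<in> carrier G \<Longrightarrow> x \<in> C \<Longrightarrow> \<phi> (J a) x = h a x" by metis
  have JjC: "\<phi> (J a) (j x) = j (\<phi> a x)" if "a \<in> carrier G" "x \<in> C" for a x
    using that Jh jcl by simp
  have Jo: "\<phi> (J a) y = y" if "a \<in> carrier G" "y \<in> C" "y \<notin> j ` C" for a y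
    using that Jh ho by simp
  show ?thesis
  proof
    show "J \<in> hom G G"
    proof (rule homI)
      show "J a \<in> carrier G" if "a \<in> carrier G" for a by (rule J [OF that])
      fix a b assume ab: "a \<in> carrier G" "b \<in> carrier G"
      show "J (a \<otimes> b) = J a \<otimes> J b"
      proof (rule act_eqI)
        fix y assume y: "y \<in> C"
        show "\<phi> (J (a \<otimes> b)) y = \<phi> (J a \<otimes> J b) y"
        proof (cases "y \<in> j ` C")
          case True
          then obtain x where x: "x \<in> C" "y = j x" by blast
          then have "\<phi> (J (a \<otimes> b)) y = j (\<phi> a (\<phi> b x))" using JjC[of "a \<otimes> b" x] ab by simp
          also have "\<dots> = \<phi> (J a) (\<phi> (J b) y)" using JjC x ab by simp
          also have "\<dots> = \<phi> (J a \<otimes> J b) y" using act_mult[OF J[OF ab(1)] J[OF ab(2)] y] by simp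
          finally show ?thesis .
        next
          case False
          then show ?thesis using act_mult[OF J[OF ab(1)] J[OF ab(2)] y] Jo y ab by simp
        qed
      qed (simp_all add: J ab)
    qed
    show "J a \<in> rist D" if "a \<in> carrier G" for a
    proof -
      have "y \<notin> j ` C" if "y \<notin> D" for y using that jcl(1) by blast
      then show ?thesis using J[OF that] Jo[OF that] by (simp add: rist_def)
    qed
    show "c \<in> carrier G" by fact
    fix x assume x: "x \<in> rist U"
    then have xc: "x \<in> carrier G" using rist_carrier by blast
    show "J x = c \<otimes> x \<otimes> inv c"
    proof (rule act_eqI)
      fix y assume y: "y \<in> C"
      show "\<phi> (J x) y = \<phi> (c \<otimes> x \<otimes> inv c) y"
      proof (cases "y \<in> \<phi> c ` U")
        case True
        then obtain u where u: "u \<in> U" "y = \<phi> c u" by blast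
        then have uC: "u \<in> C" "y = j u" "\<phi> x u \<in> U"
          using UC x rist_maps by (auto simp: j_def)
        then have "\<phi> (J x) y = \<phi> c (\<phi> x u)" using JjC xc by (simp add: j_def)
        then show ?thesis using u uC(1) xc c by simp
      next
        case False
        \<comment> \<open>Off the image of \<open>U\<close> both sides fix \<open>y\<close>: for
          \<open>J x\<close>, either \<open>y\<close> is outside the image of \<open>j\<close>, or
          it comes from a point outside \<open>U\<close>, which \<open>x\<close> fixes.\<close>
        have r: "\<phi> (c \<otimes> x \<otimes> inv c) y = y" using rist_fix[OF rist_conj[OF x c(1)] y False] .
        show ?thesis
        proof (cases "y \<in> j ` C")
          case True
          then obtain z where z: "z \<in> C" "y = j z" by blast
          then have "z \<notin> U" using False by (auto simp: j_def)
          then have "\<phi> x z = z" using rist_fix x z by blast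
          then show ?thesis using JjC[OF xc z(1)] z r by simp
        next
          case False
          then show ?thesis using Jo[OF xc y] r by simp
        qed
      qed
    qed (simp_all add: xc J c)
  qed
qed

text \<open>Take \<open>x' = [x, h]\<close> and \<open>y' = [y, k]\<close>.\<close>
lemma displaced_comm:
  assumes x: "x \<in> rist D" and y: "y \<in> rist D" and h: "h \<in> carrier G" and k: "k \<in> carrier G"
    and disj: "D \<inter> \<phi> h ` D = {}" "D \<inter> \<phi> k ` D = {}" "\<phi> h ` D \<inter> \<phi> k ` D = {}"
    and Z: "D \<subseteq> Z" "\<phi> h ` D \<subseteq> Z" "\<phi> k ` D \<subseteq> Z"
  obtains x' y' where "x' \<in> G' \<inter> rist Z" "y' \<in> G' \<inter> rist Z" "comm x y = comm x' y'"
proof -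
  define u where "u = h \<otimes> inv x \<otimes> inv h"
  define v where "v = k \<otimes> inv y \<otimes> inv k"
  have u: "u \<in> rist (\<phi> h ` D)" and v: "v \<in> rist (\<phi> k ` D)"
    unfolding u_def v_def using x y h k subgroup.m_inv_closed[OF subgroup_rist]
    by (auto intro!: rist_conj)
  note car = rist_carrier[OF x] rist_carrier[OF y] rist_carrier[OF u] rist_carrier[OF v]
  have 1: "x \<otimes> u = comm x h" "y \<otimes> v = comm y k"
    using car h k by (simp_all add: u_def v_def comm_def m_assoc)
  have "x \<otimes> u \<in> rist Z" "y \<otimes> v \<in> rist Z"
    using Z x y u v by (auto intro!: subgroup.m_closed[OF subgroup_rist] intro: rist_mono)
  moreover have "x \<otimes> u \<in> G'" "y \<otimes> v \<in> G'"
    unfolding 1 using comm_in_derived car h k by auto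
  \<comment> \<open>The extra factors live on disjoint translates of \<open>D\<close>, so they
    contribute only \<open>comm u v\<close>, which is trivial.\<close>
  moreover have "comm (x \<otimes> u) (y \<otimes> v) = comm x y \<otimes> comm u v"
    using car x y u v disj by (intro comm_mult_commuting) (auto intro: rist_commute)
  moreover have "comm u v = \<one>"
    using car u v disj by (intro comm_commuting) (auto intro: rist_commute)
  ultimately show ?thesis using that car by simp
qed

text \<open>Compression turns \<open>f\<close> into a product of commutators from
  \<open>rist D\<close>, and the Burago-Ivanov trick cuts these to two. A second compression and
  \<open>displaced_comm\<close> bring the four entries into \<open>G'\<close> with a common
  support.\<close>

lemma two_comms:
  assumes f: "f \<in> G'" "f \<in> rist U" and U: "U \<in> clopens" "U \<noteq> {}" "U \<noteq> C"
  obtains Z x y z w where "Z \<in> clopens" "Z \<noteq> {}" "Z \<noteq> C"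
    "x \<in> G' \<inter> rist Z" "y \<in> G' \<inter> rist Z" "z \<in> G' \<inter> rist Z" "w \<in> G' \<inter> rist Z"
    "f = comm x y \<otimes> comm z w"
proof -
  have UC: "U \<subseteq> C" using U clopen_subset by blast
  obtain h where h: "h \<in> carrier G" "\<phi> h ` U \<subset> U" using proximal[OF U U] by blast
  define D where "D = U - \<phi> h ` U"
  have D: "D \<in> clopens" "D \<noteq> {}" "D \<noteq> C"
    using h U UC clopen_Diff clopen_image by (auto simp: D_def)
  have DU: "D \<subseteq> U" and DC: "D \<subseteq> C" using UC by (auto simp: D_def)
  have fc: "f \<in> carrier G" using f G'_carrier by blast
  obtain J c where J: "J \<in> hom G G" "\<And>a. a \<in> carrier G \<Longrightarrow> J a \<in> rist D" "c \<in> carrier G"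
    "\<And>x. x \<in> rist U \<Longrightarrow> J x = c \<otimes> x \<otimes> inv c"
    using compression[OF U D] by blast
  obtain cs where cs: "set cs \<subseteq> derived_set G (carrier G)" "list_product G cs = f"
    using commutator_length_attained[OF f(1)] by blast
  have Jcs: "J f = list_product G (map J cs)"
    using list_product_hom[OF J(1)] cs derived_set_in_carrier by fastforce
  have "J e \<in> derived_set G (rist D)" if e: "e \<in> derived_set G (carrier G)" for e
  proof -
    obtain a b where ab: "a \<in> carrier G" "b \<in> carrier G" and "e = comm a b"
      by (rule derived_setE [OF e])
    then have "J e = comm (J a) (J b)" using hom_comm[OF J(1) ab] by simp
    then show ?thesis using derived_setI[OF J(2)[OF ab(1)] J(2)[OF ab(2)]] by (simp only:)
  qed
  then have "J ` derived_set G (carrier G) \<subseteq> derived_set G (rist D)" by (rule image_subsetI)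
  then have set: "set (map J cs) \<subseteq> derived_set G (rist D)"
    unfolding set_map using image_mono[OF cs(1), of J] by (rule subset_trans [rotated])
  \<comment> \<open>Both \<open>D\<close> and the image of \<open>U\<close> under \<open>h\<close>
    lie in \<open>U\<close>, so the product is supported on \<open>U\<close> and its conjugate on
    the image of \<open>U\<close>.\<close>
  have shift: "h \<otimes> (a \<otimes> b) \<otimes> inv h \<in> rist (\<phi> h ` U)" if "a \<in> rist D" "b \<in> rist (\<phi> h ` U)" for a b
  proof (rule rist_conj)
    show "a \<otimes> b \<in> rist U"
      using rist_mono[OF DU that(1)] rist_mono[OF psubset_imp_subset[OF h(2)] that(2)]
      by (rule subgroup.m_closed [OF subgroup_rist])
  qed (use h in simp)
  have commute: "a \<otimes> b = b \<otimes> a" if "a \<in> rist D" "b \<in> rist (\<phi> h ` U)" for a b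
    using rist_commute[OF that] by (auto simp: D_def)
  obtain F A B where F: "F \<in> carrier G" and "A \<in> rist (\<phi> h ` U)" "B \<in> rist (\<phi> h ` U)"
    and Jf: "J f = comm F h \<otimes> comm A B"
    using product_of_comms_as_two[OF h(1) subgroup_rist subgroup_rist commute shift set, folded Jcs]
    by blast
  then have AB: "A \<in> carrier G" "B \<in> carrier G" using rist_carrier by auto
  \<comment> \<open>The support of \<open>F\<close> and \<open>h\<close> is not controlled.
    \<open>J2\<close> puts all four entries into \<open>rist D\<close>, yet acts on
    \<open>J f\<close>, already in \<open>rist D\<close>, as conjugation by
    \<open>c2\<close>.\<close>
  obtain J2 c2 where J2: "J2 \<in> hom G G" "\<And>a. a \<in> carrier G \<Longrightarrow> J2 a \<in> rist D" "c2 \<in> carrier G"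
    "\<And>x. x \<in> rist D \<Longrightarrow> J2 x = c2 \<otimes> x \<otimes> inv c2"
    using compression[OF D D] by blast
  have eq: "c2 \<otimes> J f \<otimes> inv c2 = comm (J2 F) (J2 h) \<otimes> comm (J2 A) (J2 B)"
  proof -
    have "c2 \<otimes> J f \<otimes> inv c2 = J2 (J f)" using J2(4) J(2) fc by simp
    also have "\<dots> = J2 (comm F h) \<otimes> J2 (comm A B)"
      unfolding Jf using hom_mult[OF J2(1)] F AB h by simp
    finally show ?thesis using hom_comm[OF J2(1)] F AB h by simp
  qed
  have hD: "\<phi> h ` D \<subseteq> \<phi> h ` U" using DU by (rule image_mono)
  have hh: "\<phi> (h \<otimes> h) ` D = \<phi> h ` \<phi> h ` D" by (rule act_image_mult [OF h(1) h(1) DC])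
  have hhD: "\<phi> (h \<otimes> h) ` D \<subseteq> \<phi> h ` U"
    unfolding hh using hD h(2) by (intro image_mono) (rule subset_trans [OF _ psubset_imp_subset])
  \<comment> \<open>\<open>D\<close> and its translates by \<open>h\<close> and
    \<open>h \<otimes> h\<close> are pairwise disjoint inside \<open>U\<close>, so these two
    elements serve as the displacing ones in \<open>displaced_comm\<close>.\<close>
  have 1: "D \<inter> \<phi> h ` D = {}" "D \<inter> \<phi> (h \<otimes> h) ` D = {}"
    using hD hhD by (simp_all only: D_def) blast+
  have 2: "\<phi> h ` D \<inter> \<phi> (h \<otimes> h) ` D = {}"
    unfolding hh by (rule act_image_disjoint [OF h(1) DC act_image_subset [OF h(1) DC] 1(1)])
  have sub: "\<phi> h ` D \<subseteq> U" "\<phi> (h \<otimes> h) ` D \<subseteq> U" using hD hhD h by auto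
  note disp = displaced_comm[OF J2(2) J2(2) h(1) m_closed[OF h(1) h(1)] 1 2 DU sub]
  obtain x y where xy: "x \<in> G' \<inter> rist U" "y \<in> G' \<inter> rist U" "comm (J2 F) (J2 h) = comm x y"
    using disp[OF F h(1)] by blast
  obtain z w where zw: "z \<in> G' \<inter> rist U" "w \<in> G' \<inter> rist U" "comm (J2 A) (J2 B) = comm z w"
    using disp[OF AB] by blast
  \<comment> \<open>\<open>e\<close> undoes the conjugations by \<open>c\<close> and
    \<open>c2\<close> that the two compressions introduced.\<close>
  define e where "e = inv (c2 \<otimes> c)"
  have e: "e \<in> carrier G" using J J2 by (simp add: e_def)
  have conj: "e \<otimes> p \<otimes> inv e \<in> G' \<inter> rist (\<phi> e ` U)" if "p \<in> G' \<inter> rist U" for p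
    using that G'_conj[OF _ e] rist_conj[OF _ e] by (meson IntD1 IntD2 IntI)
  have car: "x \<in> carrier G" "y \<in> carrier G" "z \<in> carrier G" "w \<in> carrier G"
    using xy(1,2) zw(1,2) G'_carrier by simp_all
  have "c2 \<otimes> J f \<otimes> inv c2 = inv e \<otimes> f \<otimes> e"
    using J(4)[OF f(2)] J(3) J2(3) fc by (simp add: e_def m_assoc inv_mult_group)
  then have "inv e \<otimes> f \<otimes> e = comm x y \<otimes> comm z w" using eq xy zw by simp
  then have "f = e \<otimes> (comm x y \<otimes> comm z w) \<otimes> inv e"
    using e fc by (metis inv_cancel_left(2) inv_closed m_assoc m_closed r_inv r_one)
  also have "\<dots> = (e \<otimes> comm x y \<otimes> inv e) \<otimes> (e \<otimes> comm z w \<otimes> inv e)"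
    using e car by (simp add: m_assoc)
  also have "\<dots> = comm (e \<otimes> x \<otimes> inv e) (e \<otimes> y \<otimes> inv e) \<otimes> comm (e \<otimes> z \<otimes> inv e) (e \<otimes> w \<otimes> inv e)"
    using e car by (simp add: conj_comm)
  finally have feq: "f = \<dots>" .
  show ?thesis
  proof
    show "\<phi> e ` U \<in> clopens" by (rule clopen_image [OF e U(1)])
    show "\<phi> e ` U \<noteq> {}" using U by simp
    show "\<phi> e ` U \<noteq> C" by (rule act_image_proper [OF e UC U(3)])
  qed (rule conj xy zw feq)+
qed

section \<open>Nine conjugates and commutator width three\<close>

text \<open>Dividing \<open>f\<close> by a conjugate of \<open>g\<close> that agrees with it on a
  clopen set leaves an element supported on the complement, to which \<open>two_comms\<close>
  applies.\<close>

lemma decomposition: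
  assumes f: "f \<in> G'" "f \<noteq> \<one>" and g: "g \<in> G'" "g \<noteq> \<one>"
  obtains c Z x y z w where "c \<in> G'" "Z \<in> clopens" "Z \<noteq> {}" "Z \<noteq> C"
    "x \<in> G' \<inter> rist Z" "y \<in> G' \<inter> rist Z" "z \<in> G' \<inter> rist Z" "w \<in> G' \<inter> rist Z"
    "f = (c \<otimes> g \<otimes> inv c) \<otimes> (comm x y \<otimes> comm z w)"
proof -
  obtain c V where c: "c \<in> G'" and V: "V \<in> clopens" "V \<noteq> {}" "V \<noteq> C"
    and eq: "\<And>x. x \<in> V \<Longrightarrow> \<phi> (c \<otimes> g \<otimes> inv c) x = \<phi> f x"
    using agree_on_clopen[OF f g] by blast
  define k where "k = c \<otimes> g \<otimes> inv c"
  have k: "k \<in> G'" using G'_conj g c G'_carrier by (simp add: k_def)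
  note car = G'_carrier[OF k] G'_carrier[OF f(1)]
  have VC: "V \<subseteq> C" using V clopen_subset by blast
  have "\<phi> (inv k \<otimes> f) x = x" if "x \<in> V" for x
    using that car eq[OF that, folded k_def, symmetric] VC by auto
  then have "inv k \<otimes> f \<in> rist (C - V)" using car by (auto simp: rist_def simp del: act_mult)
  moreover have "inv k \<otimes> f \<in> G'"
    using k f subgroup.m_closed[OF subgroup_G'] subgroup.m_inv_closed[OF subgroup_G'] by blast
  moreover have "C - V \<in> clopens" "C - V \<noteq> {}" "C - V \<noteq> C"
    using V VC clopen_Diff clopen_space by auto
  ultimately obtain Z x y z w where Z: "Z \<in> clopens" "Z \<noteq> {}" "Z \<noteq> C"
    "x \<in> G' \<inter> rist Z" "y \<in> G' \<inter> rist Z" "z \<in> G' \<inter> rist Z" "w \<in> G' \<inter> rist Z"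
    "inv k \<otimes> f = comm x y \<otimes> comm z w"
    using two_comms by blast
  have "f = k \<otimes> (inv k \<otimes> f)" using car by simp
  then show ?thesis using that c Z by (simp add: k_def)
qed

text \<open>An element of \<open>G'\<close> moves \<open>Z\<close> into a set displaced by
  \<open>a\<close>, so a conjugate of \<open>a\<close> displaces \<open>Z\<close> and
  \<open>comm_as_conjugates\<close> applies. All conjugators stay in \<open>G'\<close>, where the
  class \<open>A\<close> is formed.\<close>

lemma comm_product_of_conjugates:
  assumes x: "x \<in> G' \<inter> rist Z" and y: "y \<in> G' \<inter> rist Z" and Z: "Z \<in> clopens" "Z \<noteq> {}" "Z \<noteq> C"
    and a: "a \<in> G'" "a \<noteq> \<one>"
  defines "A \<equiv> {c \<otimes> a \<otimes> inv c | c. c \<in> G'}"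
  obtains xs where "length xs = 4" "set xs \<subseteq> A \<union> (\<lambda>b. inv b) ` A" "list_product G xs = comm x y"
proof -
  have ac: "a \<in> carrier G" using a G'_carrier by blast
  obtain W where W: "W \<in> clopens" "W \<noteq> {}" "W \<inter> \<phi> a ` W = {}" "W \<union> \<phi> a ` W \<noteq> C"
    using displaced_clopen[OF ac a(2)] by blast
  have WC: "W \<subseteq> C" and ZC: "Z \<subseteq> C" using W Z clopen_subset by auto
  have "W \<noteq> C" using W(4) act_image_subset[OF ac WC] by auto
  then obtain e where e: "e \<in> G'" "\<phi> e ` Z \<subseteq> W"
    using derived_proximal[of W Z] W Z by blast
  have ec: "e \<in> carrier G" using e G'_carrier by blast
  define g where "g = inv e \<otimes> a \<otimes> e"
  have g: "g \<in> carrier G" using ec ac by (simp add: g_def)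
  have gZ: "\<phi> g ` Z \<inter> Z = {}"
  proof -
    have False if z: "z \<in> Z" "\<phi> g z \<in> Z" for z
    proof -
      have zC: "z \<in> C" using z ZC by blast
      have "\<phi> e (\<phi> g z) = \<phi> a (\<phi> e z)" using zC ec ac by (simp add: g_def)
      then have "\<phi> a (\<phi> e z) \<in> W" "\<phi> e z \<in> W" using e(2) z by (metis imageI subsetD)+
      then show False using W(3) by blast
    qed
    then show ?thesis by blast
  qed
  have xr: "x \<in> rist Z" and yr: "y \<in> rist Z" using x y by auto
  note car = rist_carrier[OF xr] rist_carrier[OF yr]
  have u: "g \<otimes> inv x \<otimes> inv g \<in> rist (\<phi> g ` Z)"
    using rist_conj g xr subgroup.m_inv_closed[OF subgroup_rist] by blast
  let ?xs = "[x \<otimes> g \<otimes> inv x, inv g, y \<otimes> g \<otimes> inv y, y \<otimes> x \<otimes> inv g \<otimes> inv (y \<otimes> x)]"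
  have "list_product G ?xs = comm x y"
    using comm_as_conjugates[OF car g rist_commute[OF u xr gZ] rist_commute[OF u yr gZ]] by simp
  moreover have "set ?xs \<subseteq> A \<union> (\<lambda>b. inv b) ` A"
  proof -
    have "p \<otimes> g \<otimes> inv p \<in> A" if "p \<in> G'" for p
    proof -
      have "p \<otimes> g \<otimes> inv p = (p \<otimes> inv e) \<otimes> a \<otimes> inv (p \<otimes> inv e)"
        using that[THEN G'_carrier] ec ac by (simp add: g_def m_assoc inv_mult_group)
      moreover have "p \<otimes> inv e \<in> G'"
        using that e subgroup.m_closed[OF subgroup_G'] subgroup.m_inv_closed[OF subgroup_G'] by blast
      ultimately show ?thesis unfolding A_def by blast
    qed
    note pA = this
    have "g \<in> A" using pA[OF subgroup.one_closed[OF subgroup_G']] g by simp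
    moreover have "y \<otimes> x \<otimes> inv g \<otimes> inv (y \<otimes> x) = inv (y \<otimes> x \<otimes> g \<otimes> inv (y \<otimes> x))"
      using car g by (simp add: m_assoc inv_mult_group)
    moreover have "y \<otimes> x \<otimes> g \<otimes> inv (y \<otimes> x) \<in> A"
      using pA x y subgroup.m_closed[OF subgroup_G'] by blast
    ultimately show ?thesis using pA x y by simp
  qed
  ultimately show ?thesis using that[of ?xs] by simp
qed

lemma nine_conjugates:
  assumes f: "f \<in> G'" "f \<noteq> \<one>" and a: "a \<in> G'" "a \<noteq> \<one>"
  defines "A \<equiv> {c \<otimes> a \<otimes> inv c | c. c \<in> G'}"
  shows "\<exists>xs. length xs \<le> 9 \<and> set xs \<subseteq> A \<union> (\<lambda>b. inv b) ` A \<and> list_product G xs = f"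
proof -
  obtain c Z x y z w where d: "c \<in> G'" "Z \<in> clopens" "Z \<noteq> {}" "Z \<noteq> C"
    "x \<in> G' \<inter> rist Z" "y \<in> G' \<inter> rist Z" "z \<in> G' \<inter> rist Z" "w \<in> G' \<inter> rist Z"
    "f = (c \<otimes> a \<otimes> inv c) \<otimes> (comm x y \<otimes> comm z w)"
    using decomposition[OF f a] by blast
  obtain xs where xs: "length xs = 4" "set xs \<subseteq> A \<union> (\<lambda>b. inv b) ` A" "list_product G xs = comm x y"
    using comm_product_of_conjugates[OF d(5,6,2,3,4) a] unfolding A_def by blast
  obtain ys where ys: "length ys = 4" "set ys \<subseteq> A \<union> (\<lambda>b. inv b) ` A" "list_product G ys = comm z w"
    using comm_product_of_conjugates[OF d(7,8,2,3,4) a] unfolding A_def by blast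
  have "A \<subseteq> carrier G" using a G'_carrier by (auto simp: A_def)
  then have "A \<union> (\<lambda>b. inv b) ` A \<subseteq> carrier G" by auto
  then have "set xs \<subseteq> carrier G" "set ys \<subseteq> carrier G" using xs(2) ys(2) by blast+
  then have "list_product G ((c \<otimes> a \<otimes> inv c) # xs @ ys) = f"
    using list_product_append[of xs ys] xs(3) ys(3) d(9) by simp
  moreover have "c \<otimes> a \<otimes> inv c \<in> A" using d(1) by (auto simp: A_def)
  ultimately show ?thesis using xs ys
    by (intro exI[of _ "(c \<otimes> a \<otimes> inv c) # xs @ ys"]) auto
qed

lemma list_product_derived [simp]: "list_product (commutator_subgroup G) = list_product G"
  by (simp add: fun_eq_iff list_product_def commutator_subgroup_def)

lemma uniformly_simple_derived: "uniformly_simple 9 (commutator_subgroup G)"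
  unfolding uniformly_simple_def
proof (intro conjI ballI impI)
  let ?N = "commutator_subgroup G"
  have N [simp]: "carrier ?N = G'" "mult ?N = mult G" "one ?N = one G"
    by (simp_all add: commutator_subgroup_def)
  show "group ?N"
    unfolding commutator_subgroup_def by (rule subgroup_imp_group[OF subgroup_G'])
  have invN: "inv\<^bsub>?N\<^esub> x = inv x" if "x \<in> G'" for x
    unfolding commutator_subgroup_def using m_inv_consistent[OF subgroup_G' that] by simp
  fix f A assume f: "f \<in> carrier ?N" and "A \<in> conjugacy_classes ?N"
    and ne: "f \<noteq> \<one>\<^bsub>?N\<^esub> \<and> A \<noteq> {\<one>\<^bsub>?N\<^esub>}"
  then obtain a where a: "a \<in> G'" and "A = conjugacy_class ?N a"
    by (auto simp: conjugacy_classes_def)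
  then have A: "A = {c \<otimes> a \<otimes> inv c | c. c \<in> G'}"
    unfolding conjugacy_class_def Setcompr_eq_image by (simp add: invN cong: image_cong)
  have "a \<noteq> \<one>"
  proof
    assume "a = \<one>"
    then have "A = {\<one>}" using subgroup.one_closed[OF subgroup_G'] G'_carrier by (force simp: A)
    then show False using ne by simp
  qed
  then obtain xs where "length xs \<le> 9" "set xs \<subseteq> A \<union> (\<lambda>b. inv b) ` A" "list_product G xs = f"
    using nine_conjugates[of f a] f ne a unfolding A by auto
  moreover have "A \<subseteq> G'" using a G'_conj G'_carrier by (auto simp: A)
  then have "(\<lambda>b. inv\<^bsub>?N\<^esub> b) ` A = (\<lambda>b. inv b) ` A"
    using invN by (intro image_cong) auto
  ultimately show "\<exists>xs. length xs \<le> 9 \<and> set xs \<subseteq> A \<union> (\<lambda>a. inv\<^bsub>?N\<^esub> a) ` A \<and> list_product ?N xs = f"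
    by auto
qed

text \<open>If the element conjugated in \<open>decomposition\<close> is itself a commutator of
  elements of \<open>G'\<close>, all three factors are such commutators.\<close>

lemma commutator_width_derived: "commutator_width (commutator_subgroup G) \<le> 3"
  unfolding commutator_width_def
proof (rule SUP_least)
  let ?N = "commutator_subgroup G"
  have cN: "carrier ?N = G'" by (simp add: commutator_subgroup_def)
  have dN: "derived ?N (carrier ?N) = derived G G'" "derived_set ?N (carrier ?N) = derived_set G G'"
    unfolding cN unfolding commutator_subgroup_def
    using derived_consistent[OF _ subgroup_G'] derived_set_consistent[OF _ subgroup_G'] by auto
  fix f assume "f \<in> derived ?N (carrier ?N)"
  then have f: "f \<in> derived G G'" using dN by simp
  have "\<exists>cs. length cs \<le> 3 \<and> set cs \<subseteq> derived_set G G' \<and> list_product G cs = f"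
  proof (cases "f = \<one>")
    case True
    then show ?thesis by (intro exI[of _ "[]"]) simp
  next
    case False
    \<comment> \<open>Otherwise the commutators of elements of \<open>G'\<close> would generate only
      the trivial group, which does not contain \<open>f\<close>.\<close>
    have "\<not> derived_set G G' \<subseteq> {\<one>}"
      using generate_subgroup_incl[OF _ triv_subgroup] f False unfolding derived_def by blast
    then obtain u v where uv: "u \<in> G'" "v \<in> G'" "comm u v \<noteq> \<one>" by (auto simp: comm_def)
    have fG: "f \<in> G'" using f mono_derived[of G' "carrier G"] G'_carrier by blast
    note uvc = G'_carrier[OF uv(1)] G'_carrier[OF uv(2)]
    obtain c Z x y z w where d: "c \<in> G'" "Z \<in> clopens" "Z \<noteq> {}" "Z \<noteq> C"
      "x \<in> G' \<inter> rist Z" "y \<in> G' \<inter> rist Z" "z \<in> G' \<inter> rist Z" "w \<in> G' \<inter> rist Z"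
      "f = (c \<otimes> comm u v \<otimes> inv c) \<otimes> (comm x y \<otimes> comm z w)"
      using decomposition[OF fG False comm_in_derived[OF uvc] uv(3)] by blast
    have cc: "c \<in> carrier G" using d G'_carrier by blast
    have zw: "comm z w \<in> carrier G" using d(7,8) G'_carrier by simp
    have "list_product G [comm (c \<otimes> u \<otimes> inv c) (c \<otimes> v \<otimes> inv c), comm x y, comm z w] = f"
      using d(9) conj_comm[OF uvc cc] zw by simp
    moreover have "set [comm (c \<otimes> u \<otimes> inv c) (c \<otimes> v \<otimes> inv c), comm x y, comm z w] \<subseteq> derived_set G G'"
      using d(5-8) uv cc G'_conj derived_setI[where H = G'] by simp
    ultimately show ?thesis
      by (intro exI[of _ "[comm (c \<otimes> u \<otimes> inv c) (c \<otimes> v \<otimes> inv c), comm x y, comm z w]"]) simp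
  qed
  then have "commutator_length ?N f \<le> 3"
    unfolding commutator_length_def dN list_product_derived by (metis (mono_tags, lifting) Least_le le_trans)
  then show "enat (commutator_length ?N f) \<le> 3" by (simp add: numeral_eq_enat)
qed

end

section \<open>Topological full groups of the Cantor set\<close>

text \<open>Some binary coordinate distinguishes the two points, and the preimage of its value at
  \<open>x\<close> is clopen.\<close>

lemma cantor_space_separation:
  assumes "cantor_space X" "x \<in> topspace X" "y \<in> topspace X" "x \<noteq> y"
  obtains K where "clopen_in X K" "x \<in> K" "y \<notin> K"
proof -
  let ?D = "discrete_topology (UNIV :: bool set)"
  let ?P = "product_topology (\<lambda>_ :: nat. ?D) UNIV"
  obtain f where f: "homeomorphic_map X ?P f"
    using assms(1) unfolding cantor_space_def homeomorphic_space by blast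
  have "f x \<noteq> f y"
    using homeomorphic_imp_injective_map[OF f] assms(2-4) by (auto dest: inj_onD)
  then obtain n where n: "f x n \<noteq> f y n" by blast
  have "continuous_map ?P ?D (\<lambda>p. p n)"
    using continuous_map_product_projection[of n UNIV "\<lambda>_. ?D"] by simp
  then have cont: "continuous_map X ?D (\<lambda>z. f z n)"
    using continuous_map_compose[OF homeomorphic_imp_continuous_map[OF f], of ?D "\<lambda>p. p n"]
    by (simp add: o_def)
  let ?K = "{z \<in> topspace X. f z n \<in> {f x n}}"
  have "openin X ?K" by (rule openin_continuous_map_preimage [OF cont]) simp
  moreover have "closedin X ?K" by (rule closedin_continuous_map_preimage [OF cont]) simp
  ultimately show ?thesis using that[of ?K] assms(2) n by (simp add: clopen_in_def)
qed

text \<open>Continuity and openness are local, so \<open>h\<close> inherits them from the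
  homeomorphisms it agrees with, and a continuous open bijection is a homeomorphism. The restriction
  supplies the extensional representative that \<open>homeo\<close> demands.\<close>

lemma topological_full_groupI:
  assumes homeos: "\<And>g. g \<in> carrier G \<Longrightarrow> homeomorphic_map X X (\<phi> g)"
    and h: "bij_betw h (topspace X) (topspace X)"
    and loc: "\<And>x. x \<in> topspace X \<Longrightarrow>
      \<exists>K. openin X K \<and> x \<in> K \<and> (\<exists>\<gamma> \<in> carrier G. \<forall>y \<in> K. h y = \<phi> \<gamma> y)"
  shows "restrict h (topspace X) \<in> topological_full_group X G \<phi>"
proof -
  let ?h = "restrict h (topspace X)"
  have loc': "\<exists>K. openin X K \<and> x \<in> K \<and> (\<exists>\<gamma> \<in> carrier G. \<forall>y \<in> K. ?h y = \<phi> \<gamma> y)"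
    if x: "x \<in> topspace X" for x
  proof -
    obtain K \<gamma> where K: "openin X K" "x \<in> K" "\<gamma> \<in> carrier G" "\<forall>y \<in> K. h y = \<phi> \<gamma> y"
      using loc[OF x] by blast
    moreover have "\<forall>y \<in> K. ?h y = \<phi> \<gamma> y" using K openin_subset[OF K(1)] by auto
    ultimately show ?thesis by blast
  qed
  have hC: "?h x \<in> topspace X" if "x \<in> topspace X" for x
    using that h bij_betwE by fastforce
  have "continuous_map X X ?h"
    unfolding continuous_map_def
  proof (intro conjI allI impI)
    show "?h \<in> topspace X \<rightarrow> topspace X" using hC by (rule Pi_I)
    fix U assume U: "openin X U"
    show "openin X {x \<in> topspace X. ?h x \<in> U}"
    proof (subst openin_subopen, intro ballI)
      fix x assume x: "x \<in> {x \<in> topspace X. ?h x \<in> U}"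
      then obtain K \<gamma> where K: "openin X K" "x \<in> K" "\<gamma> \<in> carrier G" "\<forall>y \<in> K. ?h y = \<phi> \<gamma> y"
        using loc' by blast
      let ?T = "K \<inter> {z \<in> topspace X. \<phi> \<gamma> z \<in> U}"
      have "openin X ?T"
        using K(1) openin_continuous_map_preimage[OF homeomorphic_imp_continuous_map[OF homeos[OF K(3)]] U]
        by (rule openin_Int)
      moreover have "x \<in> ?T" using x K by simp
      moreover have "?T \<subseteq> {x \<in> topspace X. ?h x \<in> U}" using K by auto
      ultimately show "\<exists>T. openin X T \<and> x \<in> T \<and> T \<subseteq> {x \<in> topspace X. ?h x \<in> U}" by blast
    qed
  qed
  moreover have "open_map X X ?h"
    unfolding open_map_def
  proof (intro allI impI)
    fix U assume U: "openin X U"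
    show "openin X (?h ` U)"
    proof (subst openin_subopen, intro ballI)
      fix y assume "y \<in> ?h ` U"
      then obtain x where x: "x \<in> U" "y = ?h x" by blast
      then have "x \<in> topspace X" using openin_subset[OF U] by blast
      then obtain K \<gamma> where K: "openin X K" "x \<in> K" "\<gamma> \<in> carrier G" "\<forall>y \<in> K. ?h y = \<phi> \<gamma> y"
        using loc' by blast
      have "openin X (\<phi> \<gamma> ` (U \<inter> K))"
        using homeomorphic_imp_open_map[OF homeos[OF K(3)]] openin_Int[OF U K(1)]
        unfolding open_map_def by blast
      moreover have "\<phi> \<gamma> ` (U \<inter> K) = ?h ` (U \<inter> K)" using K(4) by (intro image_cong) auto
      ultimately show "\<exists>T. openin X T \<and> y \<in> T \<and> T \<subseteq> ?h ` U" using x K(2) by auto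
    qed
  qed
  moreover have "?h ` topspace X = topspace X" "inj_on ?h (topspace X)"
    using h by (auto simp: bij_betw_def inj_on_def)
  ultimately have "homeomorphic_map X X ?h" by (rule bijective_open_imp_homeomorphic_map)
  then show ?thesis
    unfolding topological_full_group_def homeo_def using loc' by blast
qed

theorem theorem5p1:
  fixes G :: "('g, 'm) monoid_scheme"
    and X :: "'c topology"
    and \<phi> :: "'g \<Rightarrow> 'c \<Rightarrow> 'c"
  assumes cantor: "cantor_space X"
    and action: "faithful_action G (topspace X) \<phi>"
    and by_homeos: "\<And>g. g \<in> carrier G \<Longrightarrow> homeomorphic_map X X (\<phi> g)"
    and full: "\<phi> ` carrier G = topological_full_group X G \<phi>"
    and proximal: "extremely_proximal X G \<phi>"
  shows "uniformly_simple 9 (commutator_subgroup G)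
       \<and> commutator_width (commutator_subgroup G) \<le> 3
       \<and> (derived G (carrier G) = carrier G \<longrightarrow> uniformly_simple 9 G)"
proof -
  interpret faithful_action G "topspace X" \<phi> by fact
  interpret G: group G using group_hom by (rule group_hom.axioms(1))
  interpret full_proximal_action G "topspace X" \<phi> "Collect (clopen_in X)"
  proof
    show "K \<subseteq> topspace X" if "K \<in> Collect (clopen_in X)" for K
      using that openin_subset by (auto simp: clopen_in_def)
    show "topspace X \<in> Collect (clopen_in X)" by (simp add: clopen_in_def)
    show "K - L \<in> Collect (clopen_in X)" "K \<union> L \<in> Collect (clopen_in X)"
      if "K \<in> Collect (clopen_in X)" "L \<in> Collect (clopen_in X)" for K L
      using that by (auto simp: clopen_in_def)
    show "\<phi> g ` K \<in> Collect (clopen_in X)"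
      if g: "g \<in> carrier G" and K: "K \<in> Collect (clopen_in X)" for g K
      using K homeomorphic_imp_open_map[OF by_homeos[OF g]] homeomorphic_imp_closed_map[OF by_homeos[OF g]]
      by (simp add: clopen_in_def open_map_def closed_map_def)
    show "\<exists>K \<in> Collect (clopen_in X). x \<in> K \<and> y \<notin> K"
      if "x \<in> topspace X" "y \<in> topspace X" "x \<noteq> y" for x y
      using cantor_space_separation[OF cantor that] by blast
    show "\<exists>g \<in> carrier G. \<forall>x \<in> topspace X. \<phi> g x = h x"
      if h: "bij_betw h (topspace X) (topspace X)"
        and loc: "\<And>x. x \<in> topspace X \<Longrightarrow>
          \<exists>K \<in> Collect (clopen_in X). x \<in> K \<and> (\<exists>\<gamma> \<in> carrier G. \<forall>y \<in> K. h y = \<phi> \<gamma> y)" for h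
    proof -
      have "restrict h (topspace X) \<in> topological_full_group X G \<phi>"
        using by_homeos h
      proof (rule topological_full_groupI)
        show "\<exists>K. openin X K \<and> x \<in> K \<and> (\<exists>\<gamma> \<in> carrier G. \<forall>y \<in> K. h y = \<phi> \<gamma> y)"
          if "x \<in> topspace X" for x
          using loc[OF that] unfolding clopen_in_def by blast
      qed
      \<comment> \<open>Fullness enters here: the glued bijection lies in the topological full
        group, hence comes from an element of \<open>G\<close>.\<close>
      then obtain g where "g \<in> carrier G" "\<phi> g = restrict h (topspace X)"
        unfolding full [symmetric] by force
      then show ?thesis by (intro bexI[of _ g]) simp_all
    qed
    show "\<exists>g \<in> carrier G. \<phi> g ` V \<subset> U"
      if "U \<in> Collect (clopen_in X)" "U \<noteq> {}" "U \<noteq> topspace X"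
        "V \<in> Collect (clopen_in X)" "V \<noteq> {}" "V \<noteq> topspace X" for U V
    proof -
      have "U \<subset> topspace X" "V \<subset> topspace X"
        using that openin_subset by (auto simp: clopen_in_def)
      then show ?thesis using proximal that unfolding extremely_proximal_def by simp
    qed
  qed
  have "commutator_subgroup G = G" if "derived G (carrier G) = carrier G"
    using that by (simp add: commutator_subgroup_def)
  then show ?thesis using uniformly_simple_derived commutator_width_derived by metis
qed

end
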